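(* Let $\{W,\widetilde W,Z\}$ be a data set for an LTONP interpolation problem, with $W:\ell^2_+(\mathcal Y)\to\mathcal Z$, $\widetilde W:\ell^2_+(\mathcal U)\to\mathcal Z$, $Z:\mathcal Z\to\mathcal Z$, and assume that $\Lambda=WW^*-\widetilde W\widetilde W^*$ is strictly positive. Put $P=WW^*$, $B=WE_{\mathcal Y}$, $\widetilde B=\widetilde WE_{\mathcal U}$, let $C:\mathcal Z\to\mathcal E$ and $D:\mathcal Y\to\mathcal E$ form an admissible pair of complementary operators determined by the data set, let $$Q_\circ=\bigl(I_{\mathcal E}+CP(\Lambda^{-1}-P^{-1})PC^*\bigr)^{-1/2},\qquad R_\circ=\bigl(I_{\mathcal U}+\widetilde B^*\Lambda^{-1}\widetilde B\bigr)^{-1/2},$$ and let \begin{align*} \Upsilon_{11}(\lambda)&=D^*Q_\circ+\lambda B^*(I-\lambda Z^* )^{-1}\Lambda^{-1}PC^*Q_\circ, & \Upsilon_{12}(\lambda)&=B^*(I-\lambda Z^* )^{-1}\Lambda^{-1}\widetilde BR_\circ,\\ \Upsilon_{21}(\lambda)&=\lambda\widetilde B^*(I-\lambda Z^* )^{-1}\Lambda^{-1}PC^*Q_\circ, & \Upsilon_{22}(\lambda)&=R_\circ+\widetilde B^*(I-\lambda Z^* )^{-1}\Lambda^{-1}\widetilde BR_\circ \end{align*} for $\lambda\in\mathbb D$, and also (by the same formulas) for $\lambda\in\mathbb T$ in the resolvent set of $Z$. Then the $\Upsilon_{ij}$ are $H^2$-functions; more precisely, $$\Upsilon_{11}(\cdot)x\in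 H^2(\mathcal Y),\quad \Upsilon_{21}(\cdot)x\in H^2(\mathcal U)\quad(x\in\mathcal E),\qquad \Upsilon_{12}(\cdot)u\in H^2(\mathcal Y),\quad \Upsilon_{22}(\cdot)u\in H^2(\mathcal U)\quad(u\in\mathcal U).$$ Moreover, for all $\lambda\in\mathbb D$, $$\begin{bmatrix} \Upsilon_{11}(\lambda)^* & \Upsilon_{21}(\lambda)^* \\ \Upsilon_{12}(\lambda)^* & \Upsilon_{22}(\lambda)^* \end{bmatrix}\begin{bmatrix} I_{\mathcal Y} & 0 \\ 0 & -I_{\mathcal U} \end{bmatrix}\begin{bmatrix} \Upsilon_{11}(\lambda) & \Upsilon_{12}(\lambda) \\ \Upsilon_{21}(\lambda) & \Upsilon_{22}(\lambda) \end{bmatrix}\le\begin{bmatrix} I_{\mathcal E} & 0 \\ 0 & -I_{\mathcal U} \end{bmatrix},$$ with equality for each $\lambda$ in the intersection of the resolvent set of $Z$ and the unit circle $\mathbb T$. Furthermore, $\Upsilon_{22}(\lambda)$ is invertible for each $\lambda\in\mathbb D$ and $\lambda\mapsto\Upsilon_{22}(\lambda)^{-1}$ is a Schur class function.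
   Context: All spaces are complex Hilbert spaces and "operator" means bounded linear operator. An operator $T$ on a Hilbert space is strictly positive if $T\ge 0$ and $T$ is invertible. $\mathbb D$ is the open unit disc and $\mathbb T$ the unit circle. For a Hilbert space $\mathcal V$, $\ell^2_+(\mathcal V)$ is the space of square summable unilateral sequences in $\mathcal V$, $S_{\mathcal V}$ is the unilateral forward shift on it, and $E_{\mathcal V}:\mathcal V\to\ell^2_+(\mathcal V)$, $E_{\mathcal V}v=(v,0,0,\dots)$. $H^2(\mathcal V)$ is the Hardy space of $\mathcal V$-valued analytic functions on $\mathbb D$ whose Taylor coefficients at $0$ are square summable in norm. A Schur class function is an analytic operator-valued function $F$ on $\mathbb D$ (here with values operators on $\mathcal U$) with $\sup_{\lambda\in\mathbb D}\|F(\lambda)\|\le1$. An LTONP (left tangential operator Nevanlinna-Pick) data set is a triple of operators $Z:\mathcal Z\to\mathcal Z$, $W:\ell^2_+(\mathcal Y)\to\mathcal Z$, $\widetilde W:\ell^2_+(\mathcal U)\to\mathcal Z$ with $ZW=WS_{\mathcal Y}$ and $Z\widetilde W=\widetilde WS_{\mathcal U}$. (When $\Lambda$ is strictly positive, $P$ is strictly positive and $Z^*$ has spectral radius at most one.) With $P=WW^*$ strictly positive and $B=WE_{\mathcal Y}$, an admissible pair of complementary operators determined by the data set is a pair $C:\mathcal Z\to\mathcal E$, $D:\mathcal Y\to\mathcal E$ (with $\mathcal E$ some Hilbert space) such that $$\begin{bmatrix} D & C \\ B & Z \end{bmatrix}\begin{bmatrix} I_{\mathcal Y} & 0 \\ 0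 & P \end{bmatrix}\begin{bmatrix} D^* & B^* \\ C^* & Z^* \end{bmatrix}=\begin{bmatrix} I_{\mathcal E} & 0 \\ 0 & P \end{bmatrix},\qquad \begin{bmatrix} D^* & B^* \\ C^* & Z^* \end{bmatrix}\begin{bmatrix} I_{\mathcal E} & 0 \\ 0 & P^{-1} \end{bmatrix}\begin{bmatrix} D & C \\ B & Z \end{bmatrix}=\begin{bmatrix} I_{\mathcal Y} & 0 \\ 0 & P^{-1} \end{bmatrix}.$$ *)

theory Defs
  imports "HOL-Analysis.Analysis"
begin

section \<open>Complex Hilbert spaces\<close>

class complex_normed_vector = real_normed_vector +
  fixes scaleC :: "complex \<Rightarrow> 'a \<Rightarrow> 'a"  (infixr "*\<^sub>C" 75)
  assumes scaleC_add_right: "c *\<^sub>C (x + y) = c *\<^sub>C x + c *\<^sub>C y"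
    and scaleC_add_left: "(c + d) *\<^sub>C x = c *\<^sub>C x + d *\<^sub>C x"
    and scaleC_scaleC: "c *\<^sub>C (d *\<^sub>C x) = (c * d) *\<^sub>C x"
    and scaleR_scaleC: "r *\<^sub>R x = complex_of_real r *\<^sub>C x"
    and norm_scaleC: "norm (c *\<^sub>C x) = cmod c * norm x"

text \<open>
  The inner product is linear in the first argument. Its real part is the inner product of the
  superclass \<^class>\<open>real_inner\<close>, so definiteness and \<open>norm x = sqrt (Re (cinner x x))\<close>
  are inherited from there.
\<close>

class complex_inner = complex_normed_vector + real_inner +
  fixes cinner :: "'a \<Rightarrow> 'a \<Rightarrow> complex"
  assumes cinner_commute: "cinner x y = cnj (cinner y x)"
    and cinner_add_left: "cinner (x + y) z = cinner x z + cinner y z"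
    and cinner_scaleC_left: "cinner (c *\<^sub>C x) y = c * cinner x y"
    and Re_cinner: "Re (cinner x y) = inner x y"

class chilbert_space = complex_inner + complete_space

instantiation complex :: chilbert_space
begin

definition "scaleC c x = c * x" for c x :: complex
definition "cinner x y = x * cnj y" for x y :: complex

instance
  by standard
    (auto simp: scaleC_complex_def cinner_complex_def inner_complex_def algebra_simps norm_mult
      scaleR_conv_of_real)

end

instantiation prod :: (complex_normed_vector, complex_normed_vector) complex_normed_vector
begin

definition "scaleC c x = (c *\<^sub>C fst x, c *\<^sub>C snd x)" for x :: "'a \<times> 'b"

instance
  by standard
    (auto simp: scaleC_prod_def scaleC_add_right scaleC_add_left scaleC_scaleC scaleR_scaleC
      scaleR_prod_def norm_prod_def norm_scaleC power_mult_distrib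
      simp flip: distrib_left intro!: real_sqrt_mult[THEN trans])

end

instantiation prod :: (complex_inner, complex_inner) complex_inner
begin

definition "cinner x y = cinner (fst x) (fst y) + cinner (snd x) (snd y)" for x y :: "'a \<times> 'b"

instance
proof
  fix x y z :: "'a \<times> 'b" and c :: complex
  show "cinner x y = cnj (cinner y x)"
    unfolding cinner_prod_def complex_cnj_add cinner_commute[symmetric] ..
  show "cinner (x + y) z = cinner x z + cinner y z"
    by (simp add: cinner_prod_def cinner_add_left)
  show "cinner (c *\<^sub>C x) y = c * cinner x y"
    by (simp add: cinner_prod_def scaleC_prod_def cinner_scaleC_left distrib_left)
  show "Re (cinner x y) = inner x y"
    by (simp add: cinner_prod_def inner_prod_def Re_cinner)
qed

end

instance prod :: (chilbert_space, chilbert_space) chilbert_space ..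

lemma scaleC_zero_right [simp]: "c *\<^sub>C (0::'a::complex_normed_vector) = 0"
  using scaleC_add_right[of c 0 "0::'a"] by simp

lemma scaleC_minus_right: "c *\<^sub>C (- x) = - (c *\<^sub>C x)" for x :: "'a::complex_normed_vector"
  using scaleC_add_right[of c x "- x"] by (simp add: minus_unique)

lemma scaleC_diff_right: "c *\<^sub>C (x - y) = c *\<^sub>C x - c *\<^sub>C y"
  for x y :: "'a::complex_normed_vector"
  using scaleC_add_right[of c x "- y"] by (simp add: scaleC_minus_right)

lemma scaleC_scaleR_commute: "c *\<^sub>C (r *\<^sub>R x) = r *\<^sub>R (c *\<^sub>C x)"
  for x :: "'a::complex_normed_vector"
  by (simp add: scaleR_scaleC scaleC_scaleC mult.commute)

lemma scaleC_one: "1 *\<^sub>C x = x" for x :: "'a::complex_normed_vector"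
  using scaleR_scaleC[of 1 x] by simp

lemma cinner_conv_inner: "cinner x y = Complex (inner x y) (inner x (\<i> *\<^sub>C y))"
  for x y :: "'a::complex_inner"
proof -
  have "cinner x (\<i> *\<^sub>C y) = - \<i> * cinner x y"
    by (metis cinner_commute cinner_scaleC_left complex_cnj_i complex_cnj_mult)
  hence "inner x (\<i> *\<^sub>C y) = Im (cinner x y)"
    by (simp flip: Re_cinner)
  thus ?thesis
    by (simp add: complex_eq_iff Re_cinner)
qed

section \<open>Bounded operators\<close>

typedef (overloaded) ('a, 'b) cblinfun  ("(_ \<rightarrow>\<^sub>C /_)" [22, 21] 21) =
  "{f :: 'a::complex_normed_vector \<Rightarrow> 'b::complex_normed_vector.
      bounded_linear f \<and> (\<forall>c x. f (c *\<^sub>C x) = c *\<^sub>C f x)}"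
  morphisms cblinfun_apply Cblinfun
  by (rule exI[of _ "\<lambda>_. 0"]) simp

notation cblinfun_apply (infixr "*\<^sub>V" 70)

setup_lifting type_definition_cblinfun

lemma bounded_linear_scaleC: "bounded_linear (\<lambda>x. c *\<^sub>C x :: 'a::complex_normed_vector)"
  by (rule bounded_linear_intro[of _ "cmod c"])
    (auto simp: scaleC_add_right scaleC_scaleR_commute norm_scaleC)

lemma onorm_scaleC_le:
  fixes f :: "'a::complex_normed_vector \<Rightarrow> 'b::complex_normed_vector"
  assumes "bounded_linear f"
  shows "onorm (\<lambda>x. c *\<^sub>C f x) \<le> cmod c * onorm f"
proof (rule onorm_bound)
  show "norm (c *\<^sub>C f x) \<le> cmod c * onorm f * norm x" for x
    using onorm[OF assms, of x] by (simp add: norm_scaleC mult.assoc mult_left_mono)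
qed (simp add: onorm_pos_le[OF assms])

lemma onorm_scaleC:
  fixes f :: "'a::complex_normed_vector \<Rightarrow> 'b::complex_normed_vector"
  assumes f: "bounded_linear f"
  shows "onorm (\<lambda>x. c *\<^sub>C f x) = cmod c * onorm f"
proof (rule antisym[OF onorm_scaleC_le[OF f]])
  show "cmod c * onorm f \<le> onorm (\<lambda>x. c *\<^sub>C f x)"
  proof (cases "c = 0")
    case False
    have "bounded_linear (\<lambda>x. c *\<^sub>C f x)"
      by (rule bounded_linear_compose[OF bounded_linear_scaleC f])
    from onorm_scaleC_le[OF this, of "inverse c"] False show ?thesis
      by (simp add: scaleC_scaleC scaleC_one norm_inverse norm_divide field_simps)
  next
    case True
    have "0 \<le> onorm (\<lambda>x. c *\<^sub>C f x)"
      by (intro onorm_pos_le bounded_linear_compose[OF bounded_linear_scaleC f])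
    thus ?thesis using True by simp
  qed
qed

text \<open>The norm is the operator norm.\<close>

instantiation cblinfun :: (complex_normed_vector, complex_normed_vector) complex_normed_vector
begin

lift_definition zero_cblinfun :: "'a \<rightarrow>\<^sub>C 'b" is "\<lambda>_. 0" by simp

lift_definition plus_cblinfun :: "('a \<rightarrow>\<^sub>C 'b) \<Rightarrow> ('a \<rightarrow>\<^sub>C 'b) \<Rightarrow> ('a \<rightarrow>\<^sub>C 'b)"
  is "\<lambda>f g x. f x + g x"
  by (simp add: bounded_linear_add scaleC_add_right)

lift_definition uminus_cblinfun :: "('a \<rightarrow>\<^sub>C 'b) \<Rightarrow> ('a \<rightarrow>\<^sub>C 'b)"
  is "\<lambda>f x. - f x"
  by (simp add: bounded_linear_minus scaleC_minus_right)

lift_definition minus_cblinfun :: "('a \<rightarrow>\<^sub>C 'b) \<Rightarrow> ('a \<rightarrow>\<^sub>C 'b) \<Rightarrow> ('a \<rightarrow>\<^sub>C 'b)"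
  is "\<lambda>f g x. f x - g x"
  by (simp add: bounded_linear_sub scaleC_diff_right)

lift_definition scaleR_cblinfun :: "real \<Rightarrow> ('a \<rightarrow>\<^sub>C 'b) \<Rightarrow> ('a \<rightarrow>\<^sub>C 'b)"
  is "\<lambda>r f x. r *\<^sub>R f x"
  by (simp add: bounded_linear_const_scaleR scaleC_scaleR_commute)

lift_definition scaleC_cblinfun :: "complex \<Rightarrow> ('a \<rightarrow>\<^sub>C 'b) \<Rightarrow> ('a \<rightarrow>\<^sub>C 'b)"
  is "\<lambda>c f x. c *\<^sub>C f x"
  by (auto simp: bounded_linear_compose[OF bounded_linear_scaleC] scaleC_scaleC mult.commute)

lift_definition norm_cblinfun :: "('a \<rightarrow>\<^sub>C 'b) \<Rightarrow> real" is onorm .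

definition "dist S T = norm (S - T)" for S T :: "'a \<rightarrow>\<^sub>C 'b"
definition "sgn T = inverse (norm T) *\<^sub>R T" for T :: "'a \<rightarrow>\<^sub>C 'b"
definition [code del]:
  "(uniformity :: (('a \<rightarrow>\<^sub>C 'b) \<times> ('a \<rightarrow>\<^sub>C 'b)) filter)
    = (INF e\<in>{0<..}. principal {(S, T). dist S T < e})"
definition open_cblinfun :: "('a \<rightarrow>\<^sub>C 'b) set \<Rightarrow> bool" where [code del]:
  "open_cblinfun U = (\<forall>S\<in>U. \<forall>\<^sub>F (S', T) in uniformity. S' = S \<longrightarrow> T \<in> U)"

instance
proof
  fix R S T :: "'a \<rightarrow>\<^sub>C 'b" and a b :: real and c d :: complex
  show "R + S + T = R + (S + T)" by transfer (simp add: add.assoc)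
  show "R + S = S + R" by transfer (simp add: add.commute)
  show "0 + R = R" by transfer simp
  show "- R + R = 0" by transfer simp
  show "R - S = R + - S" by transfer simp
  show "a *\<^sub>R (R + S) = a *\<^sub>R R + a *\<^sub>R S" by transfer (simp add: scaleR_add_right)
  show "(a + b) *\<^sub>R R = a *\<^sub>R R + b *\<^sub>R R" by transfer (simp add: scaleR_add_left)
  show "a *\<^sub>R b *\<^sub>R R = (a * b) *\<^sub>R R" by transfer simp
  show "1 *\<^sub>R R = R" by transfer simp
  show "sgn R = inverse (norm R) *\<^sub>R R" by (rule sgn_cblinfun_def)
  show "dist R S = norm (R - S)" by (rule dist_cblinfun_def)
  show "(uniformity :: (('a \<rightarrow>\<^sub>C 'b) \<times> ('a \<rightarrow>\<^sub>C 'b)) filter)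
    = (INF e\<in>{0<..}. principal {(S, T). dist S T < e})" by (rule uniformity_cblinfun_def)
  show "open U = (\<forall>S\<in>U. \<forall>\<^sub>F (S', T) in uniformity. S' = S \<longrightarrow> T \<in> U)"
    for U :: "('a \<rightarrow>\<^sub>C 'b) set" by (rule open_cblinfun_def)
  show "norm R = 0 \<longleftrightarrow> R = 0" by transfer (auto simp: onorm_eq_0)
  show "norm (R + S) \<le> norm R + norm S" by transfer (simp add: onorm_triangle)
  show "norm (a *\<^sub>R R) = \<bar>a\<bar> * norm R" by transfer (simp add: onorm_scaleR)
  show "c *\<^sub>C (R + S) = c *\<^sub>C R + c *\<^sub>C S" by transfer (simp add: scaleC_add_right)
  show "(c + d) *\<^sub>C R = c *\<^sub>C R + d *\<^sub>C R" by transfer (simp add: scaleC_add_left)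
  show "c *\<^sub>C d *\<^sub>C R = (c * d) *\<^sub>C R" by transfer (simp add: scaleC_scaleC)
  show "a *\<^sub>R R = complex_of_real a *\<^sub>C R" by transfer (simp add: scaleR_scaleC)
  show "norm (c *\<^sub>C R) = cmod c * norm R" by transfer (simp add: onorm_scaleC)
qed

end

lift_definition id_op :: "'a::complex_normed_vector \<rightarrow>\<^sub>C 'a" is "\<lambda>x. x" by simp

lift_definition comp_op ::
  "('b::complex_normed_vector \<rightarrow>\<^sub>C 'c::complex_normed_vector) \<Rightarrow>
   ('a::complex_normed_vector \<rightarrow>\<^sub>C 'b) \<Rightarrow> ('a \<rightarrow>\<^sub>C 'c)"  (infixl "o\<^sub>C" 67)
  is "\<lambda>S T x. S (T x)"
  by (simp add: bounded_linear_compose)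

definition adj ::
  "('a::chilbert_space \<rightarrow>\<^sub>C 'b::chilbert_space) \<Rightarrow> ('b \<rightarrow>\<^sub>C 'a)"  ("_\<^sup>\<dagger>" [99] 100)
  where "T\<^sup>\<dagger> = (THE S. \<forall>x y. cinner (T *\<^sub>V x) y = cinner x (S *\<^sub>V y))"

definition invertible_op ::
  "('a::complex_normed_vector \<rightarrow>\<^sub>C 'b::complex_normed_vector) \<Rightarrow> bool"
  where "invertible_op T \<longleftrightarrow> (\<exists>S. S o\<^sub>C T = id_op \<and> T o\<^sub>C S = id_op)"

definition inv_op ::
  "('a::complex_normed_vector \<rightarrow>\<^sub>C 'b::complex_normed_vector) \<Rightarrow> ('b \<rightarrow>\<^sub>C 'a)"
  where "inv_op T = (THE S. S o\<^sub>C T = id_op \<and> T o\<^sub>C S = id_op)"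

definition resolvent_set :: "('a::complex_normed_vector \<rightarrow>\<^sub>C 'a) \<Rightarrow> complex set"
  where "resolvent_set T = {z. invertible_op (z *\<^sub>C id_op - T)}"

text \<open>
  The membership below says that the inner product is real and nonnegative. On a complex space this
  already forces \<open>T\<close> to be selfadjoint.
\<close>

definition positive_op :: "('a::chilbert_space \<rightarrow>\<^sub>C 'a) \<Rightarrow> bool"
  where "positive_op T \<longleftrightarrow> (\<forall>x. cinner (T *\<^sub>V x) x \<in> \<real>\<^sub>\<ge>\<^sub>0)"

definition le_op :: "('a::chilbert_space \<rightarrow>\<^sub>C 'a) \<Rightarrow> ('a \<rightarrow>\<^sub>C 'a) \<Rightarrow> bool"  (infix "\<preceq>" 50)
  where "S \<preceq> T \<longleftrightarrow> positive_op (T - S)"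

definition strictly_positive_op :: "('a::chilbert_space \<rightarrow>\<^sub>C 'a) \<Rightarrow> bool"
  where "strictly_positive_op T \<longleftrightarrow> positive_op T \<and> invertible_op T"

definition sqrt_op :: "('a::chilbert_space \<rightarrow>\<^sub>C 'a) \<Rightarrow> ('a \<rightarrow>\<^sub>C 'a)"
  where "sqrt_op T = (THE S. positive_op S \<and> S o\<^sub>C S = T)"

text \<open>The operator with block matrix \<open>[[T11, T12], [T21, T22]]\<close>.\<close>

lift_definition block_op ::
  "('a::complex_normed_vector \<rightarrow>\<^sub>C 'c::complex_normed_vector) \<Rightarrow>
   ('b::complex_normed_vector \<rightarrow>\<^sub>C 'c) \<Rightarrow>
   ('a \<rightarrow>\<^sub>C 'd::complex_normed_vector) \<Rightarrow> ('b \<rightarrow>\<^sub>C 'd) \<Rightarrow> ('a \<times> 'b) \<rightarrow>\<^sub>C ('c \<times> 'd)"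
  is "\<lambda>T11 T12 T21 T22 x. (T11 (fst x) + T12 (snd x), T21 (fst x) + T22 (snd x))"
  by (auto simp: scaleC_prod_def scaleC_add_right
      intro!: bounded_linear_Pair bounded_linear_add
        bounded_linear_compose[OF _ bounded_linear_fst] bounded_linear_compose[OF _ bounded_linear_snd])

section \<open>Square summable unilateral sequences\<close>

typedef (overloaded) 'a ell2 = "{x :: nat \<Rightarrow> 'a::chilbert_space. summable (\<lambda>n. (norm (x n))\<^sup>2)}"
  morphisms ell2_nth Abs_ell2
  by (rule exI[of _ "\<lambda>_. 0"]) simp

setup_lifting type_definition_ell2

lemma power2_norm_add_le:
  "(norm (x + y))\<^sup>2 \<le> 2 * (norm x)\<^sup>2 + 2 * (norm y)\<^sup>2" for x y :: "'a::real_normed_vector"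
proof -
  have "(norm (x + y))\<^sup>2 \<le> (norm x + norm y)\<^sup>2"
    by (simp add: norm_triangle_ineq power_mono)
  also have "\<dots> \<le> 2 * (norm x)\<^sup>2 + 2 * (norm y)\<^sup>2"
    using sum_squares_bound[of "norm x" "norm y"] by (simp add: power2_sum)
  finally show ?thesis .
qed

lemma summable_sq_add:
  fixes x y :: "nat \<Rightarrow> 'a::real_normed_vector"
  assumes "summable (\<lambda>n. (norm (x n))\<^sup>2)" "summable (\<lambda>n. (norm (y n))\<^sup>2)"
  shows "summable (\<lambda>n. (norm (x n + y n))\<^sup>2)"
  by (rule summable_comparison_test'[of "\<lambda>n. 2 * (norm (x n))\<^sup>2 + 2 * (norm (y n))\<^sup>2" 0])
    (use assms power2_norm_add_le in \<open>auto intro!: summable_add summable_mult\<close>)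

lemma summable_sq_diff:
  fixes x y :: "nat \<Rightarrow> 'a::real_normed_vector"
  assumes "summable (\<lambda>n. (norm (x n))\<^sup>2)" "summable (\<lambda>n. (norm (y n))\<^sup>2)"
  shows "summable (\<lambda>n. (norm (x n - y n))\<^sup>2)"
  using summable_sq_add[of x "\<lambda>n. - y n"] assms by simp

lemma summable_sq_inner:
  fixes x y :: "nat \<Rightarrow> 'a::real_inner"
  assumes "summable (\<lambda>n. (norm (x n))\<^sup>2)" "summable (\<lambda>n. (norm (y n))\<^sup>2)"
  shows "summable (\<lambda>n. inner (x n) (y n))"
proof (rule summable_comparison_test'[of "\<lambda>n. (norm (x n))\<^sup>2 + (norm (y n))\<^sup>2" 0])
  show "summable (\<lambda>n. (norm (x n))\<^sup>2 + (norm (y n))\<^sup>2)"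
    by (intro summable_add assms)
  fix n
  have "2 * (norm (x n) * norm (y n)) \<le> (norm (x n))\<^sup>2 + (norm (y n))\<^sup>2"
    using sum_squares_bound[of "norm (x n)" "norm (y n)"] by (simp add: mult.assoc)
  moreover have "0 \<le> norm (x n) * norm (y n)" by simp
  ultimately show "norm (inner (x n) (y n)) \<le> (norm (x n))\<^sup>2 + (norm (y n))\<^sup>2"
    using Cauchy_Schwarz_ineq2[of "x n" "y n"] by simp
qed

lemma summable_sq_cinner:
  fixes x y :: "nat \<Rightarrow> 'a::complex_inner"
  assumes "summable (\<lambda>n. (norm (x n))\<^sup>2)" "summable (\<lambda>n. (norm (y n))\<^sup>2)"
  shows "summable (\<lambda>n. cinner (x n) (y n))"
proof -
  have "summable (\<lambda>n. inner (x n) (\<i> *\<^sub>C y n))"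
    by (intro summable_sq_inner) (simp_all add: norm_scaleC assms)
  with summable_sq_inner[OF assms] show ?thesis
    by (simp add: summable_complex_iff cinner_conv_inner)
qed

instantiation ell2 :: (chilbert_space) real_inner
begin

lift_definition zero_ell2 :: "'a ell2" is "\<lambda>_. 0" by simp

lift_definition plus_ell2 :: "'a ell2 \<Rightarrow> 'a ell2 \<Rightarrow> 'a ell2" is "\<lambda>x y n. x n + y n"
  by (rule summable_sq_add)

lift_definition uminus_ell2 :: "'a ell2 \<Rightarrow> 'a ell2" is "\<lambda>x n. - x n" by simp

lift_definition minus_ell2 :: "'a ell2 \<Rightarrow> 'a ell2 \<Rightarrow> 'a ell2" is "\<lambda>x y n. x n - y n"
  by (rule summable_sq_diff)

lift_definition scaleR_ell2 :: "real \<Rightarrow> 'a ell2 \<Rightarrow> 'a ell2" is "\<lambda>r x n. r *\<^sub>R x n"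
  by (simp add: power_mult_distrib summable_mult)

lift_definition inner_ell2 :: "'a ell2 \<Rightarrow> 'a ell2 \<Rightarrow> real"
  is "\<lambda>x y. \<Sum>n. inner (x n) (y n)" .

definition "norm x = sqrt (inner x x)" for x :: "'a ell2"
definition "dist x y = norm (x - y)" for x y :: "'a ell2"
definition "sgn x = inverse (norm x) *\<^sub>R x" for x :: "'a ell2"
definition [code del]:
  "(uniformity :: ('a ell2 \<times> 'a ell2) filter) = (INF e\<in>{0<..}. principal {(x, y). dist x y < e})"
definition open_ell2 :: "'a ell2 set \<Rightarrow> bool" where [code del]:
  "open_ell2 U = (\<forall>x\<in>U. \<forall>\<^sub>F (x', y) in uniformity. x' = x \<longrightarrow> y \<in> U)"

instance
proof
  fix x y z :: "'a ell2" and a b :: real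
  show "x + y + z = x + (y + z)" by transfer (simp add: add.assoc)
  show "x + y = y + x" by transfer (simp add: add.commute)
  show "0 + x = x" by transfer simp
  show "- x + x = 0" by transfer simp
  show "x - y = x + - y" by transfer simp
  show "a *\<^sub>R (x + y) = a *\<^sub>R x + a *\<^sub>R y" by transfer (simp add: scaleR_add_right)
  show "(a + b) *\<^sub>R x = a *\<^sub>R x + b *\<^sub>R x" by transfer (simp add: scaleR_add_left)
  show "a *\<^sub>R b *\<^sub>R x = (a * b) *\<^sub>R x" by transfer simp
  show "1 *\<^sub>R x = x" by transfer simp
  show "sgn x = inverse (norm x) *\<^sub>R x" by (rule sgn_ell2_def)
  show "dist x y = norm (x - y)" by (rule dist_ell2_def)
  show "(uniformity :: ('a ell2 \<times> 'a ell2) filter)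
    = (INF e\<in>{0<..}. principal {(x, y). dist x y < e})" by (rule uniformity_ell2_def)
  show "open U = (\<forall>x\<in>U. \<forall>\<^sub>F (x', y) in uniformity. x' = x \<longrightarrow> y \<in> U)"
    for U :: "'a ell2 set" by (rule open_ell2_def)
  show "inner x y = inner y x"
    by transfer (simp add: inner_commute)
  show "inner (x + y) z = inner x z + inner y z"
    by transfer (simp add: inner_add_left suminf_add summable_sq_inner)
  show "inner (a *\<^sub>R x) y = a * inner x y"
    by transfer (simp add: suminf_mult summable_sq_inner)
  show "0 \<le> inner x x"
    by transfer (simp add: suminf_nonneg summable_sq_inner)
  show "inner x x = 0 \<longleftrightarrow> x = 0"
    by transfer (subst suminf_eq_zero_iff, auto simp: summable_sq_inner fun_eq_iff)
  show "norm x = sqrt (inner x x)"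
    by (rule norm_ell2_def)
qed

end

lemma norm_ell2_sums: "(\<lambda>n. (norm (ell2_nth x n))\<^sup>2) sums (norm x)\<^sup>2"
  unfolding power2_norm_eq_inner
  by transfer (simp add: summable_sq_inner summable_sums)

instantiation ell2 :: (chilbert_space) complex_inner
begin

lift_definition scaleC_ell2 :: "complex \<Rightarrow> 'a ell2 \<Rightarrow> 'a ell2" is "\<lambda>c x n. c *\<^sub>C x n"
  by (simp add: norm_scaleC power_mult_distrib summable_mult)

lift_definition cinner_ell2 :: "'a ell2 \<Rightarrow> 'a ell2 \<Rightarrow> complex"
  is "\<lambda>x y. \<Sum>n. cinner (x n) (y n)" .

instance
proof
  fix x y z :: "'a ell2" and a :: real and c d :: complex
  show "c *\<^sub>C (x + y) = c *\<^sub>C x + c *\<^sub>C y" by transfer (simp add: scaleC_add_right)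
  show "(c + d) *\<^sub>C x = c *\<^sub>C x + d *\<^sub>C x" by transfer (simp add: scaleC_add_left)
  show "c *\<^sub>C d *\<^sub>C x = (c * d) *\<^sub>C x" by transfer (simp add: scaleC_scaleC)
  show "a *\<^sub>R x = complex_of_real a *\<^sub>C x" by transfer (simp add: scaleR_scaleC)
  show "norm (c *\<^sub>C x) = cmod c * norm x"
  proof -
    have "(\<lambda>n. (norm (ell2_nth (c *\<^sub>C x) n))\<^sup>2) sums (cmod c * norm x)\<^sup>2"
      using sums_mult[OF norm_ell2_sums[of x], of "(cmod c)\<^sup>2"]
      by (simp add: scaleC_ell2.rep_eq norm_scaleC power_mult_distrib)
    hence "(norm (c *\<^sub>C x))\<^sup>2 = (cmod c * norm x)\<^sup>2"
      using norm_ell2_sums sums_unique2 by blast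
    thus ?thesis by (simp add: power2_eq_iff_nonneg)
  qed
  show "cinner (c *\<^sub>C x) y = c * cinner x y"
    by transfer (simp add: cinner_scaleC_left suminf_mult summable_sq_cinner)
  show "cinner (x + y) z = cinner x z + cinner y z"
    by transfer (simp add: cinner_add_left suminf_add summable_sq_cinner)
  show "cinner x y = cnj (cinner y x)"
  proof transfer
    fix x y :: "nat \<Rightarrow> 'a"
    assume "summable (\<lambda>n. (norm (x n))\<^sup>2)" "summable (\<lambda>n. (norm (y n))\<^sup>2)"
    hence "(\<lambda>n. cnj (cinner (y n) (x n))) sums cnj (\<Sum>n. cinner (y n) (x n))"
      by (intro sums_cnj[THEN iffD2] summable_sums summable_sq_cinner)
    thus "(\<Sum>n. cinner (x n) (y n)) = cnj (\<Sum>n. cinner (y n) (x n))"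
      by (simp add: sums_iff flip: cinner_commute)
  qed
  show "Re (cinner x y) = inner x y"
    by transfer (simp add: Re_suminf summable_sq_cinner Re_cinner)
qed

end

lemma norm_ell2_nth_le: "norm (ell2_nth x n) \<le> norm x"
proof -
  have "(norm (ell2_nth x n))\<^sup>2 \<le> (norm x)\<^sup>2"
    using sum_le_suminf[of "\<lambda>n. (norm (ell2_nth x n))\<^sup>2" "{n}"] norm_ell2_sums[of x]
    by (simp add: sums_iff)
  thus ?thesis by (simp add: power2_le_iff_abs_le)
qed

instance ell2 :: (chilbert_space) chilbert_space
proof
  fix X :: "nat \<Rightarrow> 'a ell2"
  assume X: "Cauchy X"
  have "Cauchy (\<lambda>m. ell2_nth (X m) n)" for n
  proof (rule metric_CauchyI)
    fix e :: real assume "0 < e"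
    then obtain M where M: "\<forall>m\<ge>M. \<forall>k\<ge>M. dist (X m) (X k) < e"
      using metric_CauchyD[OF X] by blast
    have "dist (ell2_nth (X m) n) (ell2_nth (X k) n) \<le> dist (X m) (X k)" for m k
      using norm_ell2_nth_le[of "X m - X k" n] by (simp add: dist_norm minus_ell2.rep_eq)
    with M show "\<exists>M. \<forall>m\<ge>M. \<forall>k\<ge>M. dist (ell2_nth (X m) n) (ell2_nth (X k) n) < e"
      by (meson le_less_trans)
  qed
  then obtain x where x: "\<And>n. (\<lambda>m. ell2_nth (X m) n) \<longlonglongrightarrow> x n"
    unfolding Cauchy_convergent_iff convergent_def by metis
  have tail: "summable (\<lambda>n. (norm (ell2_nth (X m) n - x n))\<^sup>2) \<and>
      (\<Sum>n. (norm (ell2_nth (X m) n - x n))\<^sup>2) \<le> e\<^sup>2"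
    if M: "\<forall>m\<ge>M. \<forall>k\<ge>M. dist (X m) (X k) < e" and m: "m \<ge> M" for e M m
  proof -
    have "(\<Sum>n<K. (norm (ell2_nth (X m) n - x n))\<^sup>2) \<le> e\<^sup>2" for K
    proof (rule LIMSEQ_le_const2)
      show "(\<lambda>k. \<Sum>n<K. (norm (ell2_nth (X m) n - ell2_nth (X k) n))\<^sup>2)
          \<longlonglongrightarrow> (\<Sum>n<K. (norm (ell2_nth (X m) n - x n))\<^sup>2)"
        by (intro tendsto_intros x)
      have "(\<Sum>n<K. (norm (ell2_nth (X m) n - ell2_nth (X k) n))\<^sup>2) \<le> e\<^sup>2" if "k \<ge> M" for k
      proof -
        have "(\<Sum>n<K. (norm (ell2_nth (X m - X k) n))\<^sup>2) \<le> (norm (X m - X k))\<^sup>2"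
          using sum_le_suminf[of "\<lambda>n. (norm (ell2_nth (X m - X k) n))\<^sup>2" "{..<K}"]
            norm_ell2_sums[of "X m - X k"] by (simp add: sums_iff)
        also have "\<dots> \<le> e\<^sup>2"
          using M m that by (intro power_mono) (auto simp: dist_norm intro: less_imp_le)
        finally show ?thesis by (simp add: minus_ell2.rep_eq)
      qed
      thus "\<exists>N. \<forall>k\<ge>N. (\<Sum>n<K. (norm (ell2_nth (X m) n - ell2_nth (X k) n))\<^sup>2) \<le> e\<^sup>2" by blast
    qed
    hence "summable (\<lambda>n. (norm (ell2_nth (X m) n - x n))\<^sup>2)"
      by (intro summableI_nonneg_bounded[where x = "e\<^sup>2"]) auto
    thus ?thesis
      using \<open>\<And>K. (\<Sum>n<K. (norm (ell2_nth (X m) n - x n))\<^sup>2) \<le> e\<^sup>2\<close>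
      by (auto intro: suminf_le_const)
  qed
  obtain M1 where M1: "\<forall>m\<ge>M1. \<forall>k\<ge>M1. dist (X m) (X k) < 1"
    using metric_CauchyD[OF X zero_less_one] by blast
  have "summable (\<lambda>n. (norm (ell2_nth (X M1) n - (ell2_nth (X M1) n - x n)))\<^sup>2)"
    by (rule summable_sq_diff[OF sums_summable[OF norm_ell2_sums] conjunct1[OF tail[OF M1 order_refl]]])
  hence "summable (\<lambda>n. (norm (x n))\<^sup>2)" by simp
  then obtain y where y: "ell2_nth y = x"
    using Abs_ell2_inverse[of x] by blast
  have "X \<longlonglongrightarrow> y"
  proof (rule metric_LIMSEQ_I)
    fix e :: real assume "0 < e"
    hence "0 < e / 2" by simp
    then obtain M where M: "\<forall>m\<ge>M. \<forall>k\<ge>M. dist (X m) (X k) < e / 2"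
      using metric_CauchyD[OF X] by blast
    have "dist (X m) y < e" if "m \<ge> M" for m
    proof -
      have "(norm (X m - y))\<^sup>2 \<le> (e / 2)\<^sup>2"
        using tail[OF M that] norm_ell2_sums[of "X m - y"]
        by (simp add: sums_iff minus_ell2.rep_eq y)
      hence "norm (X m - y) \<le> e / 2"
        by (rule power2_le_imp_le) (use \<open>0 < e\<close> in simp)
      thus ?thesis using \<open>0 < e\<close> by (simp add: dist_norm)
    qed
    thus "\<exists>N. \<forall>m\<ge>N. dist (X m) y < e" by blast
  qed
  thus "convergent X" by (auto simp: convergent_def)
qed

lift_definition shift_ell2 :: "'a::chilbert_space ell2 \<Rightarrow> 'a ell2"
  is "\<lambda>x n. case n of 0 \<Rightarrow> 0 | Suc m \<Rightarrow> x m"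
  by (subst summable_Suc_iff[symmetric]) simp

lift_definition embed_ell2 :: "'a::chilbert_space \<Rightarrow> 'a ell2"
  is "\<lambda>v n. if n = 0 then v else 0"
  by (rule summable_finite[of "{0}"]) auto

lemma norm_shift_ell2: "norm (shift_ell2 x) = norm x"
proof -
  have "(\<lambda>n. (norm (ell2_nth (shift_ell2 x) n))\<^sup>2) sums (norm x)\<^sup>2"
    using sums_Suc[of "\<lambda>n. (norm (ell2_nth (shift_ell2 x) n))\<^sup>2"] norm_ell2_sums[of x]
    by (simp add: shift_ell2.rep_eq)
  hence "(norm (shift_ell2 x))\<^sup>2 = (norm x)\<^sup>2"
    using norm_ell2_sums sums_unique2 by blast
  thus ?thesis by simp
qed

lemma norm_embed_ell2: "norm (embed_ell2 v) = norm v"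
proof -
  have "(\<lambda>n. (norm (ell2_nth (embed_ell2 v) n))\<^sup>2) sums (norm v)\<^sup>2"
    using sums_single[of 0 "\<lambda>n. (norm v)\<^sup>2"]
    by (simp add: embed_ell2.rep_eq if_distrib[of norm] if_distribR if_distrib[of "\<lambda>r. r\<^sup>2"] cong: if_cong)
  hence "(norm (embed_ell2 v))\<^sup>2 = (norm v)\<^sup>2"
    using norm_ell2_sums sums_unique2 by blast
  thus ?thesis by simp
qed

lift_definition shift_op :: "'a::chilbert_space ell2 \<rightarrow>\<^sub>C 'a ell2" is shift_ell2
proof
  show "bounded_linear (shift_ell2 :: 'a ell2 \<Rightarrow> _)"
    by (rule bounded_linear_intro[of _ 1])
      (simp_all add: norm_shift_ell2, (transfer, auto split: nat.splits)+)
  show "\<forall>c x. shift_ell2 (c *\<^sub>C x) = c *\<^sub>C (shift_ell2 x :: 'a ell2)"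
    by transfer (auto split: nat.splits)
qed

lift_definition embed_op :: "'a::chilbert_space \<rightarrow>\<^sub>C 'a ell2" is embed_ell2
proof
  show "bounded_linear (embed_ell2 :: 'a \<Rightarrow> _)"
    by (rule bounded_linear_intro[of _ 1])
      (simp_all add: norm_embed_ell2, (transfer, auto)+)
  show "\<forall>c x. embed_ell2 (c *\<^sub>C x) = c *\<^sub>C (embed_ell2 (x :: 'a))"
    by transfer auto
qed

section \<open>Analytic functions on the unit disc\<close>

text \<open>
  Only the values on the open unit disc matter. The Frechet derivative at each point is required to
  be of the form \<open>h \<mapsto> h d\<close>, that is, \<open>d\<close> is the complex derivative. For operator-valued functions
  the topology is that of the operator norm.
\<close>

definition analytic_on_disc :: "(complex \<Rightarrow> 'a::complex_normed_vector) \<Rightarrow> bool"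
  where "analytic_on_disc f \<longleftrightarrow>
    (\<forall>z\<in>ball 0 1. \<exists>d. (f has_derivative (\<lambda>h. h *\<^sub>C d)) (at z))"

text \<open>The \<open>a n\<close> are the Taylor coefficients of \<open>f\<close> at the origin.\<close>

definition hardy_H2 :: "(complex \<Rightarrow> 'v::chilbert_space) set"
  where "hardy_H2 = {f. analytic_on_disc f \<and>
    (\<exists>a. (\<forall>z\<in>ball 0 1. (\<lambda>n. z ^ n *\<^sub>C a n) sums f z) \<and> summable (\<lambda>n. (norm (a n))\<^sup>2))}"

definition schur_class ::
  "(complex \<Rightarrow> 'u::chilbert_space \<rightarrow>\<^sub>C 'v::chilbert_space) set"
  where "schur_class = {F. analytic_on_disc F \<and> (\<forall>z\<in>ball 0 1. norm (F z) \<le> 1)}"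

section \<open>The interpolation problem\<close>

definition LTONP_data ::
  "('z::chilbert_space \<rightarrow>\<^sub>C 'z) \<Rightarrow> ('y::chilbert_space ell2 \<rightarrow>\<^sub>C 'z) \<Rightarrow>
   ('u::chilbert_space ell2 \<rightarrow>\<^sub>C 'z) \<Rightarrow> bool"
  where "LTONP_data Z W Wt \<longleftrightarrow> Z o\<^sub>C W = W o\<^sub>C shift_op \<and> Z o\<^sub>C Wt = Wt o\<^sub>C shift_op"

text \<open>Meaningful when \<open>P = W o\<^sub>C W\<^sup>\<dagger>\<close> is strictly positive.\<close>

definition admissible_pair ::
  "('z::chilbert_space \<rightarrow>\<^sub>C 'z) \<Rightarrow> ('y::chilbert_space ell2 \<rightarrow>\<^sub>C 'z) \<Rightarrow>
   ('z \<rightarrow>\<^sub>C 'e::chilbert_space) \<Rightarrow> ('y \<rightarrow>\<^sub>C 'e) \<Rightarrow> bool"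
  where "admissible_pair Z W C D \<longleftrightarrow>
    (let P = W o\<^sub>C W\<^sup>\<dagger>; B = W o\<^sub>C embed_op in
      block_op D C B Z o\<^sub>C block_op id_op 0 0 P o\<^sub>C block_op (D\<^sup>\<dagger>) (B\<^sup>\<dagger>) (C\<^sup>\<dagger>) (Z\<^sup>\<dagger>)
        = block_op id_op 0 0 P \<and>
      block_op (D\<^sup>\<dagger>) (B\<^sup>\<dagger>) (C\<^sup>\<dagger>) (Z\<^sup>\<dagger>) o\<^sub>C block_op id_op 0 0 (inv_op P) o\<^sub>C block_op D C B Z
        = block_op id_op 0 0 (inv_op P))"

end

theory Submission
  imports Defs
begin

text \<open>
  The matrix function \<open>\<Upsilon>\<close> is the transfer function of a linear system with state operator \<open>Z\<^sup>*\<close>. The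
  Stein equation \<open>\<Lambda> - Z \<Lambda> Z\<^sup>* = B B\<^sup>* - Bt Bt\<^sup>*\<close>, the relations \<open>D D\<^sup>* + C P C\<^sup>* = I\<close> and
  \<open>B D\<^sup>* + Z P C\<^sup>* = 0\<close> of an admissible pair, and the normalisations by \<open>Q\<close> and \<open>R\<close> make this system
  preserve energy when the state \<open>x\<close> is weighted by \<open>\<langle>\<Lambda> x, x\<rangle>\<close> and the second channel counts
  negatively. At frequency \<open>z\<close> consecutive states differ by the factor \<open>z\<close>, so the defect of
  \<open>\<Upsilon>(z)\<close> from being \<open>J\<close>-isometric is \<open>(1 - |z|\<^sup>2) \<langle>\<Lambda> \<xi>, \<xi>\<rangle>\<close>, which is nonnegative in the disc and
  vanishes on the circle. The Taylor coefficients of \<open>B\<^sup>* (I - z Z\<^sup>*)\<^sup>-\<^sup>1 x\<close> are the entries of \<open>W\<^sup>* x\<close>,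
  hence square summable. The \<open>J\<close>-contractivity bounds \<open>\<Upsilon>22(z)\<close> below by 1, and since \<open>\<Upsilon>22(0)\<close> is
  invertible, so is \<open>\<Upsilon>22(z)\<close> on the whole connected disc.
\<close>

section \<open>Operator algebra, operator norm and complex inner product\<close>

instance chilbert_space \<subseteq> banach ..

lemma scaleC_zero_left [simp]: "0 *\<^sub>C x = (0 :: 'a::complex_normed_vector)"
  using scaleR_scaleC[of 0 x] by simp

lemma cblinfun_eqI: "(\<And>x. S *\<^sub>V x = T *\<^sub>V x) \<Longrightarrow> S = T"
  by transfer auto

lemma bounded_linear_cblinfun_apply: "bounded_linear (cblinfun_apply T)"
  using cblinfun_apply[of T] by simp

lemma cblinfun_apply_scaleC: "T *\<^sub>V (c *\<^sub>C x) = c *\<^sub>C (T *\<^sub>V x)"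
  using cblinfun_apply[of T] by simp

lemmas cblinfun_simps =
  comp_op.rep_eq id_op.rep_eq zero_cblinfun.rep_eq plus_cblinfun.rep_eq minus_cblinfun.rep_eq
  uminus_cblinfun.rep_eq scaleR_cblinfun.rep_eq scaleC_cblinfun.rep_eq block_op.rep_eq
  linear_add[OF bounded_linear.linear[OF bounded_linear_cblinfun_apply]]
  linear_diff[OF bounded_linear.linear[OF bounded_linear_cblinfun_apply]]
  linear_neg[OF bounded_linear.linear[OF bounded_linear_cblinfun_apply]]
  linear_0[OF bounded_linear.linear[OF bounded_linear_cblinfun_apply]]
  linear_scale[OF bounded_linear.linear[OF bounded_linear_cblinfun_apply]]
  cblinfun_apply_scaleC

lemma norm_cblinfun_apply_le: "norm (T *\<^sub>V x) \<le> norm T * norm x"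
  using onorm[OF bounded_linear_cblinfun_apply, of T x] by (simp add: norm_cblinfun.rep_eq)

lemma norm_cblinfun_leI: "norm T \<le> b" if "\<And>x. norm (T *\<^sub>V x) \<le> b * norm x" "0 \<le> b"
  using onorm_bound[of b "cblinfun_apply T"] that by (simp add: norm_cblinfun.rep_eq)

lemma norm_comp_op_le: "norm (S o\<^sub>C T) \<le> norm S * norm T"
proof (rule norm_cblinfun_leI)
  fix x
  have "norm (S *\<^sub>V (T *\<^sub>V x)) \<le> norm S * norm (T *\<^sub>V x)"
    by (rule norm_cblinfun_apply_le)
  also have "\<dots> \<le> norm S * (norm T * norm x)"
    by (intro mult_left_mono norm_cblinfun_apply_le) simp
  finally show "norm ((S o\<^sub>C T) *\<^sub>V x) \<le> norm S * norm T * norm x"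
    by (simp add: cblinfun_simps mult.assoc)
qed simp

lemma norm_id_op_le: "norm id_op \<le> 1"
  by (rule norm_cblinfun_leI) (simp_all add: cblinfun_simps)

lemma bounded_bilinear_comp_op: "bounded_bilinear (o\<^sub>C)"
proof
  show "\<exists>K. \<forall>(a :: 'a \<rightarrow>\<^sub>C 'b) (b :: 'c \<rightarrow>\<^sub>C 'a). norm (a o\<^sub>C b) \<le> norm a * norm b * K"
    by (rule exI[of _ 1]) (simp add: norm_comp_op_le)
qed (auto intro!: cblinfun_eqI simp: cblinfun_simps)

lemma comp_op_assoc: "(R o\<^sub>C S) o\<^sub>C T = R o\<^sub>C (S o\<^sub>C T)"
  by (rule cblinfun_eqI) (simp add: cblinfun_simps)

lemma comp_op_id [simp]: "T o\<^sub>C id_op = T" "id_op o\<^sub>C T = T"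
  by (rule cblinfun_eqI, simp add: cblinfun_simps)+

lemma comp_op_scaleC: "(c *\<^sub>C S) o\<^sub>C T = c *\<^sub>C (S o\<^sub>C T)" "S o\<^sub>C (c *\<^sub>C T) = c *\<^sub>C (S o\<^sub>C T)"
  by (rule cblinfun_eqI, simp add: cblinfun_simps)+

lemmas comp_op_linear =
  bounded_bilinear.add_left[OF bounded_bilinear_comp_op]
  bounded_bilinear.add_right[OF bounded_bilinear_comp_op]
  bounded_bilinear.diff_left[OF bounded_bilinear_comp_op]
  bounded_bilinear.diff_right[OF bounded_bilinear_comp_op]
  bounded_bilinear.scaleR_left[OF bounded_bilinear_comp_op]
  bounded_bilinear.scaleR_right[OF bounded_bilinear_comp_op]
  bounded_bilinear.minus_left[OF bounded_bilinear_comp_op]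
  bounded_bilinear.minus_right[OF bounded_bilinear_comp_op]
  comp_op_scaleC

lemma bounded_linear_eval: "bounded_linear (\<lambda>T. T *\<^sub>V x)"
  by (rule bounded_linear_intro[of _ "norm x"])
    (simp_all add: cblinfun_simps norm_cblinfun_apply_le mult.commute[of "norm x"])

text \<open>Completeness is borrowed from the real bounded linear maps \<open>blinfun\<close>, which
  carry the same norm; complex homogeneity survives the pointwise limit. The Neumann series and the
  fixed point argument for square roots rest on this.\<close>

instance cblinfun :: (complex_normed_vector, chilbert_space) banach
proof
  fix X :: "nat \<Rightarrow> 'a \<rightarrow>\<^sub>C 'b" assume X: "Cauchy X"
  define Y where "Y n = Blinfun (cblinfun_apply (X n))" for n
  have Y: "blinfun_apply (Y n) = cblinfun_apply (X n)" for n
    unfolding Y_def by (rule bounded_linear_Blinfun_apply[OF bounded_linear_cblinfun_apply])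
  have dist: "norm (Y m - Y n) = norm (X m - X n)" for m n
    by (simp add: norm_blinfun.rep_eq norm_cblinfun.rep_eq minus_blinfun.rep_eq
        minus_cblinfun.rep_eq Y)
  have "Cauchy Y"
    using X by (simp add: Cauchy_def dist_norm dist)
  then obtain L where L: "Y \<longlonglongrightarrow> L"
    by (auto simp: Cauchy_convergent_iff convergent_def)
  have lim: "(\<lambda>n. X n *\<^sub>V x) \<longlonglongrightarrow> blinfun_apply L x" for x
    using blinfun.tendsto[OF L tendsto_const[of x]] by (simp add: Y)
  have "blinfun_apply L (c *\<^sub>C x) = c *\<^sub>C blinfun_apply L x" for c x
    using bounded_linear.tendsto[OF bounded_linear_scaleC lim, of c x] lim[of "c *\<^sub>C x"]
    by (simp add: cblinfun_apply_scaleC LIMSEQ_unique)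
  then obtain T where T: "cblinfun_apply T = blinfun_apply L"
    using Cblinfun_inverse[of "blinfun_apply L"] by (auto simp: bounded_linear_blinfun_apply)
  have "norm (X n - T) = norm (Y n - L)" for n
    by (simp add: norm_blinfun.rep_eq norm_cblinfun.rep_eq minus_blinfun.rep_eq
        minus_cblinfun.rep_eq Y T)
  with L have "X \<longlonglongrightarrow> T"
    by (simp add: tendsto_iff dist_norm)
  thus "convergent X" by (auto simp: convergent_def)
qed

lemma cinner_add_right: "cinner x (y + z) = cinner x y + cinner x z"
  by (metis cinner_add_left cinner_commute complex_cnj_add)

lemma cinner_scaleC_right: "cinner x (c *\<^sub>C y) = cnj c * cinner x y"
  by (metis cinner_commute cinner_scaleC_left complex_cnj_mult)

lemma cinner_minus_left: "cinner (- x) y = - cinner x y"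
  using cinner_scaleC_left[of "-1" x y] scaleR_scaleC[of "-1" x] by simp

lemma cinner_minus_right: "cinner x (- y) = - cinner x y"
  by (metis cinner_commute cinner_minus_left complex_cnj_minus)

lemma cinner_diff_left: "cinner (x - y) z = cinner x z - cinner y z"
  using cinner_add_left[of x "- y" z] by (simp add: cinner_minus_left)

lemma cinner_diff_right: "cinner x (y - z) = cinner x y - cinner x z"
  using cinner_add_right[of x y "- z"] by (simp add: cinner_minus_right)

lemma cinner_zero [simp]: "cinner 0 x = 0" "cinner x 0 = 0"
  using cinner_diff_left[of 0 0 x] cinner_diff_right[of x 0 0] by simp_all

lemmas cinner_simps = cinner_add_left cinner_add_right cinner_diff_left cinner_diff_right
  cinner_minus_left cinner_minus_right cinner_scaleC_left cinner_scaleC_right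

lemma cinner_self: "cinner x x = complex_of_real ((norm x)\<^sup>2)"
proof -
  have "Im (cinner x x) = 0"
    using arg_cong[OF cinner_commute[of x x], of Im] by simp
  thus ?thesis
    by (simp add: complex_eq_iff Re_cinner power2_norm_eq_inner)
qed

lemma cinner_right_eqI: "x = y" if "\<And>z. cinner z x = cinner z y"
proof -
  have "cinner (x - y) (x - y) = 0"
    using that by (simp add: cinner_diff_right)
  thus ?thesis by (simp add: cinner_self)
qed

section \<open>Adjoints\<close>

text \<open>The representing vector minimises \<open>\<parallel>x\<parallel>\<^sup>2 - 2 f x\<close>; by the parallelogram law every minimising
  sequence is Cauchy.\<close>

theorem riesz_representation_real:
  fixes f :: "'a::{real_inner, complete_space} \<Rightarrow> real"
  assumes f: "bounded_linear f"
  obtains y where "\<And>x. f x = inner x y"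
proof -
  interpret f: bounded_linear f by (rule f)
  define q where "q x = (norm x)\<^sup>2 - 2 * f x" for x
  obtain K where K: "\<bar>f x\<bar> \<le> norm x * K" for x
    using f.bounded by auto
  have "- K\<^sup>2 \<le> q x" for x
  proof -
    have "(norm x)\<^sup>2 - 2 * (norm x * K) \<le> q x"
      using K[of x] unfolding q_def by linarith
    moreover have "0 \<le> (norm x - K)\<^sup>2" by simp
    ultimately show ?thesis by (simp add: power2_diff mult.assoc)
  qed
  hence bdd: "bdd_below (range q)" by (auto simp: bdd_below_def)
  define m where "m = Inf (range q)"
  have m: "m \<le> q x" for x
    unfolding m_def by (rule cInf_lower[OF _ bdd]) simp
  have "\<exists>x. q x < m + inverse (real (Suc n))" for n
    using cInf_lessD[of "range q" "m + inverse (real (Suc n))"] unfolding m_def by auto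
  then obtain x where x: "q (x n) < m + inverse (real (Suc n))" for n
    by metis
  \<comment> \<open>Comparing with the midpoint cancels the linear part of \<open>q\<close>, and the
    value at the midpoint is at least \<open>m\<close>.\<close>
  have par: "(norm (u - v))\<^sup>2 \<le> 2 * (q u - m) + 2 * (q v - m)" for u v
  proof -
    have "(norm (u - v))\<^sup>2 = 2 * q u + 2 * q v - 4 * q ((1/2) *\<^sub>R (u + v))"
      unfolding q_def f.scaleR f.add power2_norm_eq_inner
      by (simp add: inner_simps inner_commute algebra_simps)
    with m[of "(1/2) *\<^sub>R (u + v)"] show ?thesis by simp
  qed
  have q_lim: "(\<lambda>n. q (x n)) \<longlonglongrightarrow> m"
  proof (rule tendsto_sandwich[OF _ _ tendsto_const])
    show "(\<lambda>n. m + inverse (real (Suc n))) \<longlonglongrightarrow> m"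
      using tendsto_add[OF tendsto_const[of m] LIMSEQ_inverse_real_of_nat] by simp
  qed (use m x in \<open>auto intro!: always_eventually less_imp_le\<close>)
  have "Cauchy x"
  proof (rule metric_CauchyI)
    fix e :: real assume e: "0 < e"
    have "\<forall>\<^sub>F n in sequentially. q (x n) < m + e\<^sup>2 / 4"
      using order_tendstoD(2)[OF q_lim, of "m + e\<^sup>2 / 4"] e by simp
    then obtain N where N: "q (x n) < m + e\<^sup>2 / 4" if "n \<ge> N" for n
      by (auto simp: eventually_sequentially)
    have "dist (x i) (x j) < e" if "i \<ge> N" "j \<ge> N" for i j
    proof -
      have "(norm (x i - x j))\<^sup>2 < e\<^sup>2"
        using par[of "x i" "x j"] N[OF that(1)] N[OF that(2)] by (simp add: field_simps)
      thus ?thesis using e by (simp add: dist_norm power2_less_imp_less)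
    qed
    thus "\<exists>M. \<forall>i\<ge>M. \<forall>j\<ge>M. dist (x i) (x j) < e" by blast
  qed
  then obtain y where y: "x \<longlonglongrightarrow> y"
    by (auto simp: Cauchy_convergent_iff convergent_def)
  have "(\<lambda>n. q (x n)) \<longlonglongrightarrow> q y"
    unfolding q_def by (intro tendsto_intros f.tendsto y)
  hence qy: "q y = m" using q_lim LIMSEQ_unique by blast
  have "f h = inner h y" for h
  proof (rule ccontr)
    assume neq: "f h \<noteq> inner h y"
    define d where "d = f h - inner h y"
    \<comment> \<open>Minimality of \<open>y\<close> is tested along the line
      \<open>y + t h\<close>. The choice \<open>t = d / (norm h)\<^sup>2\<close> below is the
      optimal one and forces \<open>d = 0\<close>.\<close>
    have quad: "2 * t * d \<le> t\<^sup>2 * (norm h)\<^sup>2" for t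
      using m[of "y + t *\<^sub>R h"] unfolding qy[symmetric] q_def d_def f.scaleR f.add
        power2_norm_eq_inner
      by (simp add: inner_simps inner_commute power2_eq_square algebra_simps)
    have "h \<noteq> 0" using neq f.zero by auto
    hence "2 * (d / (norm h)\<^sup>2) * d \<le> (d / (norm h)\<^sup>2)\<^sup>2 * (norm h)\<^sup>2"
      by (intro quad)
    also have "\<dots> = d\<^sup>2 / (norm h)\<^sup>2"
      using \<open>h \<noteq> 0\<close> by (simp add: power2_eq_square field_simps)
    finally have "d\<^sup>2 / (norm h)\<^sup>2 \<le> 0"
      by (simp add: power2_eq_square)
    hence "d = 0" using \<open>h \<noteq> 0\<close> by (simp add: divide_le_0_iff)
    thus False using neq by (simp add: d_def)
  qed
  thus thesis by (rule that)
qed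

text \<open>The real part of \<open>f\<close> already determines the representing vector; evaluating
  at \<open>\<i> *\<^sub>C x\<close> recovers the imaginary part.\<close>

lemma riesz_representation:
  fixes f :: "'a::chilbert_space \<rightarrow>\<^sub>C complex"
  obtains y where "\<And>x. f *\<^sub>V x = cinner x y"
proof -
  have "bounded_linear (\<lambda>x. Re (f *\<^sub>V x))"
    by (rule bounded_linear_compose[OF bounded_linear_Re bounded_linear_cblinfun_apply])
  then obtain y where y: "Re (f *\<^sub>V x) = inner x y" for x
    by (rule riesz_representation_real) blast
  have "f *\<^sub>V x = cinner x y" for x
  proof (rule complex_eqI)
    show "Re (f *\<^sub>V x) = Re (cinner x y)"
      by (simp add: y Re_cinner)
    have "- Im (f *\<^sub>V x) = Re (f *\<^sub>V (\<i> *\<^sub>C x))"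
      by (simp add: cblinfun_apply_scaleC scaleC_complex_def)
    also have "\<dots> = - Im (cinner x y)"
      unfolding y by (simp add: cinner_scaleC_left flip: Re_cinner)
    finally show "Im (f *\<^sub>V x) = Im (cinner x y)" by simp
  qed
  thus thesis by (rule that)
qed

text \<open>Rotating \<open>x\<close> by a unimodular scalar makes the inner product real and
  nonnegative, so the real Cauchy-Schwarz inequality applies.\<close>

lemma cmod_cinner_le: "cmod (cinner x y) \<le> norm x * norm y"
proof (cases "cinner x y = 0")
  case False
  define c where "c = cnj (sgn (cinner x y))"
  have "c * cinner x y = complex_of_real (cmod (cinner x y))"
    using False complex_norm_square[of "cinner x y"]
    by (simp add: c_def sgn_eq field_simps power2_eq_square)
  hence "cmod (cinner x y) = inner (c *\<^sub>C x) y"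
    by (simp add: cinner_scaleC_left flip: Re_cinner)
  also have "\<dots> \<le> norm (c *\<^sub>C x) * norm y"
    by (rule norm_cauchy_schwarz)
  also have "\<dots> = norm x * norm y"
    using False by (simp add: norm_scaleC c_def norm_sgn)
  finally show ?thesis .
qed simp

lemma adj_exists: "\<exists>S. \<forall>x y. cinner (T *\<^sub>V x) y = cinner x (S *\<^sub>V y)"
  for T :: "'a::chilbert_space \<rightarrow>\<^sub>C 'b::chilbert_space"
proof -
  have "\<exists>s. \<forall>x. cinner (T *\<^sub>V x) y = cinner x s" for y
  proof -
    have "bounded_linear (\<lambda>x. cinner (T *\<^sub>V x) y)"
    proof (rule bounded_linear_intro[of _ "norm T * norm y"])
      fix x
      have "norm (cinner (T *\<^sub>V x) y) \<le> norm (T *\<^sub>V x) * norm y"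
        by (rule cmod_cinner_le)
      also have "\<dots> \<le> (norm T * norm x) * norm y"
        by (intro mult_right_mono norm_cblinfun_apply_le) simp
      finally show "norm (cinner (T *\<^sub>V x) y) \<le> norm x * (norm T * norm y)"
        by (simp add: mult_ac)
    qed (simp_all add: cblinfun_simps cinner_simps scaleR_scaleC scaleC_complex_def)
    hence "cblinfun_apply (Cblinfun (\<lambda>x. cinner (T *\<^sub>V x) y)) = (\<lambda>x. cinner (T *\<^sub>V x) y)"
      by (intro Cblinfun_inverse) (simp add: cblinfun_simps cinner_simps scaleC_complex_def)
    then obtain f where f: "f *\<^sub>V x = cinner (T *\<^sub>V x) y" for x
      by metis
    show ?thesis
      by (rule riesz_representation[of f]) (auto simp: f)
  qed
  then obtain S where S: "cinner (T *\<^sub>V x) y = cinner x (S y)" for x y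
    by metis
  have "bounded_linear S"
  proof (rule bounded_linear_intro[of _ "norm T"])
    fix x y
    show "S (x + y) = S x + S y"
      by (rule cinner_right_eqI) (simp add: cinner_simps flip: S)
    show "S (r *\<^sub>R x) = r *\<^sub>R S x" for r
      by (rule cinner_right_eqI) (simp add: cinner_simps scaleR_scaleC flip: S)
    \<comment> \<open>The defining identity evaluated at the vector \<open>S x\<close> itself bounds
      \<open>S\<close> by the norm of \<open>T\<close>.\<close>
    have "(norm (S x))\<^sup>2 = cmod (cinner (T *\<^sub>V S x) x)"
      by (simp add: S cinner_self norm_power)
    also have "\<dots> \<le> norm (T *\<^sub>V S x) * norm x"
      by (rule cmod_cinner_le)
    also have "\<dots> \<le> (norm T * norm (S x)) * norm x"
      by (intro mult_right_mono norm_cblinfun_apply_le) simp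
    finally show "norm (S x) \<le> norm x * norm T"
      by (cases "norm (S x) = 0") (simp_all add: power2_eq_square mult_ac)
  qed
  moreover have "S (c *\<^sub>C x) = c *\<^sub>C S x" for c x
    by (rule cinner_right_eqI) (simp add: cinner_simps flip: S)
  ultimately have "cblinfun_apply (Cblinfun S) = S"
    using Cblinfun_inverse[of S] by simp
  thus ?thesis using S by metis
qed

lemma cinner_adj: "cinner (T *\<^sub>V x) y = cinner x (T\<^sup>\<dagger> *\<^sub>V y)"
proof -
  have "\<exists>!S. \<forall>x y. cinner (T *\<^sub>V x) y = cinner x (S *\<^sub>V y)"
  proof (rule ex_ex1I[OF adj_exists])
    fix S S' assume "\<forall>x y. cinner (T *\<^sub>V x) y = cinner x (S *\<^sub>V y)"
      and "\<forall>x y. cinner (T *\<^sub>V x) y = cinner x (S' *\<^sub>V y)"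
    hence eq: "cinner z (S *\<^sub>V y) = cinner z (S' *\<^sub>V y)" for y z by simp
    show "S = S'"
      by (rule cblinfun_eqI, rule cinner_right_eqI, rule eq)
  qed
  from theI'[OF this, folded adj_def] show ?thesis by blast
qed

lemma cinner_adj': "cinner x (T *\<^sub>V y) = cinner (T\<^sup>\<dagger> *\<^sub>V x) y"
  using cinner_adj[of T y x] cinner_commute[of x "T *\<^sub>V y"] cinner_commute[of "T\<^sup>\<dagger> *\<^sub>V x" y]
  by simp

lemma adj_eqI: "T\<^sup>\<dagger> = S" if "\<And>x y. cinner (T *\<^sub>V x) y = cinner x (S *\<^sub>V y)"
  by (rule cblinfun_eqI, rule cinner_right_eqI, simp add: that flip: cinner_adj)

lemma adj_comp: "(S o\<^sub>C T)\<^sup>\<dagger> = T\<^sup>\<dagger> o\<^sub>C S\<^sup>\<dagger>"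
  by (rule adj_eqI) (simp add: cblinfun_simps cinner_adj)

lemma adj_adj [simp]: "(T\<^sup>\<dagger>)\<^sup>\<dagger> = T"
  by (rule adj_eqI) (simp add: cinner_adj')

lemma adj_id [simp]: "id_op\<^sup>\<dagger> = id_op"
  by (rule adj_eqI) (simp add: cblinfun_simps)

lemma adj_diff: "(S - T)\<^sup>\<dagger> = S\<^sup>\<dagger> - T\<^sup>\<dagger>"
  by (rule adj_eqI) (simp add: cblinfun_simps cinner_simps cinner_adj)

lemma adj_scaleC: "(c *\<^sub>C T)\<^sup>\<dagger> = cnj c *\<^sub>C T\<^sup>\<dagger>"
  by (rule adj_eqI) (simp add: cblinfun_simps cinner_simps cinner_adj)

lemma adj_add: "(S + T)\<^sup>\<dagger> = S\<^sup>\<dagger> + T\<^sup>\<dagger>"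
  by (rule adj_eqI) (simp add: cblinfun_simps cinner_simps cinner_adj)

text \<open>Polarisation with \<open>x + z\<close> and \<open>x + \<i> z\<close> recovers the
  sesquilinear form from its diagonal. This gives selfadjointness of positive operators, and later
  the equality on the circle.\<close>

lemma cblinfun_eq_quadraticI:
  fixes S T :: "'a::chilbert_space \<rightarrow>\<^sub>C 'a"
  assumes "\<And>x. cinner (S *\<^sub>V x) x = cinner (T *\<^sub>V x) x"
  shows "S = T"
proof (rule cblinfun_eqI, rule cinner_right_eqI)
  fix x z
  define A where "A = S - T"
  have q: "cinner (A *\<^sub>V w) w = 0" for w
    by (simp add: A_def cblinfun_simps cinner_simps assms)
  have "cinner (A *\<^sub>V x) z + cinner (A *\<^sub>V z) x = 0"
    using q[of "x + z"] by (simp add: cblinfun_simps cinner_simps q add.commute)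
  moreover have "\<i> * cinner (A *\<^sub>V z) x = \<i> * cinner (A *\<^sub>V x) z"
    using q[of "x + \<i> *\<^sub>C z"] by (simp add: cblinfun_simps cinner_simps q algebra_simps)
  ultimately have "cinner (A *\<^sub>V x) z = 0"
    by simp
  thus "cinner z (S *\<^sub>V x) = cinner z (T *\<^sub>V x)"
    using cinner_commute[of z "A *\<^sub>V x"] by (simp add: A_def cblinfun_simps cinner_simps)
qed

lemma positive_op_adj: "T\<^sup>\<dagger> = T" if "positive_op T"
proof (rule cblinfun_eq_quadraticI)
  fix x
  have "cinner (T *\<^sub>V x) x \<in> \<real>"
    using that nonneg_Reals_subset_Reals by (auto simp: positive_op_def)
  thus "cinner (T\<^sup>\<dagger> *\<^sub>V x) x = cinner (T *\<^sub>V x) x"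
    using cinner_adj'[of x T x] cinner_commute[of x "T *\<^sub>V x"] by (simp add: Reals_cnj_iff)
qed

text \<open>Separates selfadjointness from a sign condition on the real inner product, so that the
  later estimates can be purely real.\<close>

lemma positive_op_iff: "positive_op T \<longleftrightarrow> T\<^sup>\<dagger> = T \<and> (\<forall>x. 0 \<le> inner (T *\<^sub>V x) x)"
proof
  assume T: "positive_op T"
  thus "T\<^sup>\<dagger> = T \<and> (\<forall>x. 0 \<le> inner (T *\<^sub>V x) x)"
    by (auto simp: positive_op_adj positive_op_def complex_nonneg_Reals_iff Re_cinner)
next
  assume T: "T\<^sup>\<dagger> = T \<and> (\<forall>x. 0 \<le> inner (T *\<^sub>V x) x)"
  have "cinner (T *\<^sub>V x) x = cnj (cinner (T *\<^sub>V x) x)" for x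
    using T cinner_adj[of T x x] cinner_commute[of x "T *\<^sub>V x"] by simp
  hence "Im (cinner (T *\<^sub>V x) x) = 0" for x
    by (metis Reals_cnj_iff complex_is_Real_iff)
  thus "positive_op T"
    using T by (auto simp: positive_op_def complex_nonneg_Reals_iff Re_cinner)
qed

lemma inner_adj: "inner (T *\<^sub>V x) y = inner x (T\<^sup>\<dagger> *\<^sub>V y)"
  by (simp add: cinner_adj flip: Re_cinner)

lemma norm_adj_le: "norm (T\<^sup>\<dagger>) \<le> norm T"
proof (rule norm_cblinfun_leI)
  fix y
  have "(norm (T\<^sup>\<dagger> *\<^sub>V y))\<^sup>2 = inner (T *\<^sub>V (T\<^sup>\<dagger> *\<^sub>V y)) y"
    by (simp add: inner_adj power2_norm_eq_inner)
  also have "\<dots> \<le> norm (T *\<^sub>V (T\<^sup>\<dagger> *\<^sub>V y)) * norm y"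
    by (rule norm_cauchy_schwarz)
  also have "\<dots> \<le> (norm T * norm (T\<^sup>\<dagger> *\<^sub>V y)) * norm y"
    by (intro mult_right_mono norm_cblinfun_apply_le) simp
  finally show "norm (T\<^sup>\<dagger> *\<^sub>V y) \<le> norm T * norm y"
    by (cases "norm (T\<^sup>\<dagger> *\<^sub>V y) = 0") (simp_all add: power2_eq_square mult_ac)
qed simp

text \<open>The imaginary part of \<open>cinner\<close> is a real inner product against
  \<open>\<i> *\<^sub>C y\<close>, so real symmetry is enough. In this form selfadjointness is
  visibly a closed condition, as the fixed point argument for square roots requires.\<close>

lemma adj_eq_iff_inner: "T\<^sup>\<dagger> = T \<longleftrightarrow> (\<forall>x y. inner (T *\<^sub>V x) y = inner x (T *\<^sub>V y))"
proof
  assume T: "\<forall>x y. inner (T *\<^sub>V x) y = inner x (T *\<^sub>V y)"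
  show "T\<^sup>\<dagger> = T"
  proof (rule adj_eqI)
    show "cinner (T *\<^sub>V x) y = cinner x (T *\<^sub>V y)" for x y
      unfolding cinner_conv_inner by (simp add: T flip: cblinfun_apply_scaleC)
  qed
qed (metis inner_adj)

section \<open>Inverses\<close>

lemma inv_op_eqI: "inv_op T = S" if "S o\<^sub>C T = id_op" "T o\<^sub>C S = id_op"
  unfolding inv_op_def
proof (rule the_equality)
  fix S' assume "S' o\<^sub>C T = id_op \<and> T o\<^sub>C S' = id_op"
  thus "S' = S"
    using that comp_op_assoc[of S' T S] by simp
qed (simp add: that)

lemma inv_op: "inv_op T o\<^sub>C T = id_op" "T o\<^sub>C inv_op T = id_op" if "invertible_op T"
  using that inv_op_eqI[of _ T] by (auto simp: invertible_op_def)

lemma inv_op_apply [simp]: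
  assumes "invertible_op T"
  shows "inv_op T *\<^sub>V (T *\<^sub>V x) = x" "T *\<^sub>V (inv_op T *\<^sub>V y) = y"
  using inv_op[OF assms] by (metis comp_op.rep_eq id_op.rep_eq)+

lemma invertible_opI: "invertible_op T" if "S o\<^sub>C T = id_op" "T o\<^sub>C S' = id_op"
proof -
  have "S = S'"
    using that comp_op_assoc[of S T S'] by simp
  thus ?thesis using that by (auto simp: invertible_op_def)
qed

lemma invertible_op_comp: "invertible_op (S o\<^sub>C T)" if S: "invertible_op S" and T: "invertible_op T"
proof (rule invertible_opI)
  show "(inv_op T o\<^sub>C inv_op S) o\<^sub>C (S o\<^sub>C T) = id_op" "(S o\<^sub>C T) o\<^sub>C (inv_op T o\<^sub>C inv_op S) = id_op"
    by (rule cblinfun_eqI, simp add: cblinfun_simps S T)+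
qed

lemma invertible_op_scaleC: "invertible_op (c *\<^sub>C T)" if T: "invertible_op T" and c: "c \<noteq> 0"
proof (rule invertible_opI)
  show "(inverse c *\<^sub>C inv_op T) o\<^sub>C (c *\<^sub>C T) = id_op" "(c *\<^sub>C T) o\<^sub>C (inverse c *\<^sub>C inv_op T) = id_op"
    by (rule cblinfun_eqI, simp add: cblinfun_simps T c scaleC_scaleC scaleC_one)+
qed

lemma invertible_op_adj: "invertible_op (T\<^sup>\<dagger>)" if "invertible_op T"
proof (rule invertible_opI)
  show "(inv_op T)\<^sup>\<dagger> o\<^sub>C T\<^sup>\<dagger> = id_op" "T\<^sup>\<dagger> o\<^sub>C (inv_op T)\<^sup>\<dagger> = id_op"
    using inv_op[OF that] by (metis adj_comp adj_id)+
qed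

lemma adj_inv_op: "(inv_op T)\<^sup>\<dagger> = inv_op (T\<^sup>\<dagger>)" if "invertible_op T"
proof (rule inv_op_eqI[symmetric])
  show "(inv_op T)\<^sup>\<dagger> o\<^sub>C T\<^sup>\<dagger> = id_op" "T\<^sup>\<dagger> o\<^sub>C (inv_op T)\<^sup>\<dagger> = id_op"
    using inv_op[OF that] by (metis adj_comp adj_id)+
qed

primrec op_power :: "('a::complex_normed_vector \<rightarrow>\<^sub>C 'a) \<Rightarrow> nat \<Rightarrow> ('a \<rightarrow>\<^sub>C 'a)" where
  "op_power T 0 = id_op"
| "op_power T (Suc n) = T o\<^sub>C op_power T n"

lemma op_power_Suc_right: "op_power T (Suc n) = op_power T n o\<^sub>C T"
proof (induction n)
  case (Suc n)
  have "op_power T (Suc (Suc n)) = T o\<^sub>C (op_power T n o\<^sub>C T)"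
    using Suc by simp
  thus ?case by (simp add: comp_op_assoc)
qed simp

lemma op_power_scaleC: "op_power (c *\<^sub>C T) n = c ^ n *\<^sub>C op_power T n"
  by (induction n) (simp_all add: scaleC_one comp_op_scaleC scaleC_scaleC mult.commute)

lemma norm_op_power_le: "norm (op_power T n) \<le> norm T ^ n"
proof (induction n)
  case (Suc n)
  have "norm (T o\<^sub>C op_power T n) \<le> norm T * norm (op_power T n)"
    by (rule norm_comp_op_le)
  also have "\<dots> \<le> norm T * norm T ^ n"
    using Suc by (rule mult_left_mono) simp
  finally show ?case by simp
qed (simp add: norm_id_op_le)

text \<open>The telescoping series inverts \<open>id_op - T\<close>. Summability is asked of the
  powers, not of \<open>norm T ^ n\<close>, because the series is later applied to
  \<open>z *\<^sub>C T\<close> with \<open>T\<close> merely power bounded, whose norm may exceed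
  1.\<close>

theorem neumann_series:
  fixes T :: "'a::chilbert_space \<rightarrow>\<^sub>C 'a"
  assumes "summable (\<lambda>n. norm (op_power T n))"
  shows "invertible_op (id_op - T)" and "op_power T sums inv_op (id_op - T)"
proof -
  define S where "S = suminf (op_power T)"
  have S: "op_power T sums S"
    unfolding S_def by (rule summable_sums[OF summable_norm_cancel[OF assms]])
  have Suc: "(\<lambda>n. op_power T (Suc n)) sums (S - id_op)"
    using S by (subst sums_Suc_iff) simp
  have "T o\<^sub>C S = S - id_op"
    using bounded_linear.sums[OF bounded_bilinear.bounded_linear_right[OF bounded_bilinear_comp_op] S]
      Suc by (auto intro: sums_unique2)
  moreover have "S o\<^sub>C T = S - id_op"
    using bounded_linear.sums[OF bounded_bilinear.bounded_linear_left[OF bounded_bilinear_comp_op] S]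
      Suc unfolding op_power_Suc_right by (auto intro: sums_unique2)
  ultimately have *: "S o\<^sub>C (id_op - T) = id_op" "(id_op - T) o\<^sub>C S = id_op"
    by (simp_all add: comp_op_linear)
  from * show "invertible_op (id_op - T)" by (rule invertible_opI)
  from inv_op_eqI[OF *] S show "op_power T sums inv_op (id_op - T)" by simp
qed

lemma invertible_op_id_diff: "invertible_op (id_op - T)" if "norm T < 1"
  for T :: "'a::chilbert_space \<rightarrow>\<^sub>C 'a"
proof (rule neumann_series(1), rule summable_comparison_test'[of "\<lambda>n. norm T ^ n" 0])
  show "summable (\<lambda>n. norm T ^ n)"
    using that by (simp add: summable_geometric)
qed (simp add: norm_op_power_le)

text \<open>Factor \<open>S\<close> as \<open>T\<close> composed with
  \<open>id_op - inv_op T o\<^sub>C (T - S)\<close>, a perturbation of the identity of norm below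
  1.\<close>

lemma invertible_op_near:
  fixes S T :: "'a::chilbert_space \<rightarrow>\<^sub>C 'b::chilbert_space"
  assumes T: "invertible_op T" and near: "norm (inv_op T) * norm (T - S) < 1"
  shows "invertible_op S"
proof -
  have "invertible_op (id_op - inv_op T o\<^sub>C (T - S))"
    using norm_comp_op_le[of "inv_op T" "T - S"] near by (intro invertible_op_id_diff) simp
  moreover have "S = T o\<^sub>C (id_op - inv_op T o\<^sub>C (T - S))"
    by (rule cblinfun_eqI) (simp add: cblinfun_simps T)
  ultimately show ?thesis
    using invertible_op_comp[OF T] by metis
qed

section \<open>Coercive operators and their square roots\<close>

text \<open>For selfadjoint operators this amounts to strict positivity, in a form that passes
  directly to larger operators.\<close>

definition coercive_op :: "('a::chilbert_space \<rightarrow>\<^sub>C 'a) \<Rightarrow> bool"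
  where "coercive_op T \<longleftrightarrow> (\<exists>c>0. \<forall>x. c * (norm x)\<^sup>2 \<le> inner (T *\<^sub>V x) x)"

lemma coercive_op_mono: "coercive_op T"
  if "coercive_op S" "\<And>x. inner (S *\<^sub>V x) x \<le> inner (T *\<^sub>V x) x"
  using that unfolding coercive_op_def by (meson order_trans)

lemma coercive_op_ge_id: "coercive_op T" if "\<And>x. (norm x)\<^sup>2 \<le> inner (T *\<^sub>V x) x"
  unfolding coercive_op_def by (rule exI[of _ 1]) (simp add: that)

text \<open>Expanding the square of \<open>x - t T x\<close>, the linear gain \<open>2 t c\<close>
  outweighs the quadratic loss for small \<open>t\<close>. Invertibility and the square root both
  start from this rescaling.\<close>

lemma coercive_op_norm_less_one:
  assumes "coercive_op T"
  obtains t where "0 < t" "norm (id_op - t *\<^sub>R T) < 1"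
proof -
  obtain c where c: "0 < c" and T: "c * (norm x)\<^sup>2 \<le> inner (T *\<^sub>V x) x" for x
    using assms by (auto simp: coercive_op_def)
  \<comment> \<open>The summand \<open>c\<^sup>2\<close> makes \<open>N\<close> positive and ensures
    \<open>t * c \<le> 1\<close>, so that the square root below is of a nonnegative number.\<close>
  define N where "N = (norm T)\<^sup>2 + c\<^sup>2"
  define t where "t = c / N"
  have N: "0 < N" using c by (simp add: N_def add_nonneg_pos)
  have t: "0 < t" using c N by (simp add: t_def)
  have tN: "t\<^sup>2 * N = t * c"
    using N by (simp add: t_def power2_eq_square)
  have "t * c \<le> 1"
    using N by (simp add: t_def N_def power2_eq_square)
  have "norm (id_op - t *\<^sub>R T) \<le> sqrt (1 - t * c)"
  proof (rule norm_cblinfun_leI)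
    fix x
    have "(norm (T *\<^sub>V x))\<^sup>2 \<le> (norm T * norm x)\<^sup>2"
      by (intro power_mono norm_cblinfun_apply_le) simp
    also have "\<dots> \<le> N * (norm x)\<^sup>2"
      by (simp add: N_def power_mult_distrib mult_right_mono)
    finally have "t\<^sup>2 * (norm (T *\<^sub>V x))\<^sup>2 \<le> t * c * (norm x)\<^sup>2"
      using mult_left_mono[of "(norm (T *\<^sub>V x))\<^sup>2" "N * (norm x)\<^sup>2" "t\<^sup>2"] tN
      by (simp flip: mult.assoc)
    moreover have "(norm (x - t *\<^sub>R (T *\<^sub>V x)))\<^sup>2
        = (norm x)\<^sup>2 - 2 * t * inner (T *\<^sub>V x) x + t\<^sup>2 * (norm (T *\<^sub>V x))\<^sup>2"
      unfolding power2_norm_eq_inner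
      by (simp add: inner_diff_left inner_diff_right inner_commute power2_eq_square)
    moreover have "t * (c * (norm x)\<^sup>2) \<le> t * inner (T *\<^sub>V x) x"
      using T t by (intro mult_left_mono) simp_all
    ultimately have "(norm (x - t *\<^sub>R (T *\<^sub>V x)))\<^sup>2 \<le> (1 - t * c) * (norm x)\<^sup>2"
      by (simp add: algebra_simps)
    also have "\<dots> = (sqrt (1 - t * c) * norm x)\<^sup>2"
      using \<open>t * c \<le> 1\<close> by (simp add: power_mult_distrib)
    finally show "norm ((id_op - t *\<^sub>R T) *\<^sub>V x) \<le> sqrt (1 - t * c) * norm x"
      using power2_le_imp_le[of "norm (x - t *\<^sub>R (T *\<^sub>V x))"] \<open>t * c \<le> 1\<close>
      by (simp add: cblinfun_simps)
  qed (use \<open>t * c \<le> 1\<close> in simp)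
  also have "\<dots> < 1"
    using t c by simp
  finally show thesis using t that by blast
qed

lemma coercive_op_invertible: "invertible_op T" if T: "coercive_op T"
proof -
  obtain t where t: "0 < t" "norm (id_op - t *\<^sub>R T) < 1"
    using coercive_op_norm_less_one[OF T] by blast
  have "invertible_op (t *\<^sub>R T)"
    using invertible_op_id_diff[OF t(2)] by simp
  from invertible_op_scaleC[OF this, of "complex_of_real (inverse t)"] t(1) show ?thesis
    unfolding scaleR_scaleC[symmetric] by simp
qed

text \<open>Positivity of the form at \<open>x - T x / N\<close> bounds it below at \<open>x\<close>
  by \<open>(norm (T x))\<^sup>2 / N\<close>, and the bounded inverse controls \<open>norm x\<close>
  by \<open>norm (T x)\<close>.\<close>

lemma strictly_positive_op_coercive: "coercive_op T" if "strictly_positive_op T"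
proof -
  have pos: "0 \<le> inner (T *\<^sub>V x) x" and sa: "T\<^sup>\<dagger> = T" and inv: "invertible_op T" for x
    using that by (auto simp: strictly_positive_op_def positive_op_iff)
  \<comment> \<open>The added ones keep both constants positive, also when the norms vanish.\<close>
  define N where "N = norm T + 1"
  define K where "K = norm (inv_op T) + 1"
  have N: "0 < N" and K: "0 < K"
    by (simp_all add: N_def K_def add_nonneg_pos)
  have "1 / (K\<^sup>2 * N) * (norm x)\<^sup>2 \<le> inner (T *\<^sub>V x) x" for x
  proof -
    define y where "y = T *\<^sub>V x"
    have "inner (T *\<^sub>V y) y \<le> norm (T *\<^sub>V y) * norm y"
      by (rule norm_cauchy_schwarz)
    also have "\<dots> \<le> (norm T * norm y) * norm y"
      by (intro mult_right_mono norm_cblinfun_apply_le) simp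
    also have "\<dots> \<le> N * (norm y)\<^sup>2"
      by (simp add: N_def power2_eq_square algebra_simps)
    finally have "(1 / N)\<^sup>2 * inner (T *\<^sub>V y) y \<le> (1 / N)\<^sup>2 * (N * (norm y)\<^sup>2)"
      by (intro mult_left_mono) simp_all
    moreover have "(1 / N)\<^sup>2 * (N * (norm y)\<^sup>2) = (norm y)\<^sup>2 / N"
      using N by (simp add: power2_eq_square field_simps)
    moreover have "inner (T *\<^sub>V y) x = (norm y)\<^sup>2"
      using inner_adj[of T y x] by (simp add: sa y_def power2_norm_eq_inner)
    hence "inner (T *\<^sub>V (x - (1 / N) *\<^sub>R y)) (x - (1 / N) *\<^sub>R y)
        = inner (T *\<^sub>V x) x - 2 * ((norm y)\<^sup>2 / N) + (1 / N)\<^sup>2 * inner (T *\<^sub>V y) y"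
      unfolding power2_norm_eq_inner
      by (simp add: cblinfun_simps inner_diff_left inner_diff_right power2_eq_square algebra_simps
          flip: y_def)
    ultimately have "(norm y)\<^sup>2 / N \<le> inner (T *\<^sub>V x) x"
      using pos[of "x - (1 / N) *\<^sub>R y"] by linarith
    have "norm (inv_op T *\<^sub>V y) \<le> norm (inv_op T) * norm y"
      by (rule norm_cblinfun_apply_le)
    also have "\<dots> \<le> K * norm y"
      by (simp add: K_def mult_right_mono)
    finally have "norm x \<le> K * norm y"
      by (simp add: y_def inv)
    hence "(norm x)\<^sup>2 \<le> (K * norm y)\<^sup>2"
      by (intro power_mono) simp_all
    hence "1 / (K\<^sup>2 * N) * (norm x)\<^sup>2 \<le> 1 / (K\<^sup>2 * N) * (K * norm y)\<^sup>2"
      using N by (intro mult_left_mono) simp_all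
    also have "\<dots> = (norm y)\<^sup>2 / N"
      using K by (simp add: power_mult_distrib)
    also note \<open>\<dots> \<le> inner (T *\<^sub>V x) x\<close>
    finally show ?thesis .
  qed
  thus ?thesis
    using N K unfolding coercive_op_def by (intro exI[of _ "1 / (K\<^sup>2 * N)"]) simp
qed

text \<open>After scaling \<open>T\<close> so that \<open>A = I - T\<close> has norm \<open>r < 1\<close>, the map \<open>Y \<mapsto> (A + Y\<^sup>2) / 2\<close> is a
  contraction of the selfadjoint ball of radius \<open>r\<close>, and its fixed point is \<open>I - T\<^sup>1\<^sup>/\<^sup>2\<close>.\<close>

lemma sqrt_exists:
  assumes T: "coercive_op T" "T\<^sup>\<dagger> = T"
  obtains S :: "'a::chilbert_space \<rightarrow>\<^sub>C 'a" where "S o\<^sub>C S = T" "coercive_op S" "S\<^sup>\<dagger> = S"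
    "\<And>X. X o\<^sub>C T = T o\<^sub>C X \<Longrightarrow> X o\<^sub>C S = S o\<^sub>C X"
proof -
  obtain t where t: "0 < t" "norm (id_op - t *\<^sub>R T) < 1"
    using coercive_op_norm_less_one[OF T(1)] by blast
  define A where "A = id_op - t *\<^sub>R T"
  define r where "r = norm A"
  have r: "0 \<le> r" "r < 1" using t by (simp_all add: r_def A_def)
  define F where "F Y = (1/2) *\<^sub>R (A + Y o\<^sub>C Y)" for Y
  \<comment> \<open>Selfadjointness and commutation with everything that commutes with
    \<open>T\<close> are built in as closed conditions, so the fixed point inherits them; the
    commutation later yields uniqueness of the root.\<close>
  define M where "M = {Y. norm Y \<le> r} \<inter> (\<Inter>x y. {Y. inner (Y *\<^sub>V x) y = inner x (Y *\<^sub>V y)}) \<inter>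
    (\<Inter>X\<in>{X. X o\<^sub>C T = T o\<^sub>C X}. {Y. X o\<^sub>C Y = Y o\<^sub>C X})"
  have "closed {Y. inner (Y *\<^sub>V x) y = inner x (Y *\<^sub>V y)}" for x y :: 'a
    by (intro closed_Collect_eq continuous_on_inner continuous_on_const
        bounded_linear.continuous_on[OF bounded_linear_eval continuous_on_id])
  moreover have "closed {Y. X o\<^sub>C Y = Y o\<^sub>C X}" for X :: "'a \<rightarrow>\<^sub>C 'a"
    by (intro closed_Collect_eq continuous_on_const continuous_on_id
        bounded_bilinear.continuous_on[OF bounded_bilinear_comp_op])
  moreover have "closed {Y :: 'a \<rightarrow>\<^sub>C 'a. norm Y \<le> r}"
    by (intro closed_Collect_le continuous_on_const continuous_on_norm_id)
  ultimately have "closed M"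
    unfolding M_def by (intro closed_Int closed_INT ballI)
  hence "complete M" by (simp add: complete_eq_closed)
  have M_norm: "norm Y \<le> r" and M_adj: "Y\<^sup>\<dagger> = Y"
    and M_comm: "X o\<^sub>C T = T o\<^sub>C X \<Longrightarrow> X o\<^sub>C Y = Y o\<^sub>C X" if "Y \<in> M" for X Y
    using that unfolding M_def adj_eq_iff_inner by blast+
  have M_I: "Y \<in> M" if "norm Y \<le> r" "Y\<^sup>\<dagger> = Y" "\<And>X. X o\<^sub>C T = T o\<^sub>C X \<Longrightarrow> X o\<^sub>C Y = Y o\<^sub>C X" for Y
    using that unfolding M_def adj_eq_iff_inner by blast
  note \<open>complete M\<close>
  moreover have "0 \<in> M"
    using r by (intro M_I cblinfun_eqI adj_eqI) (simp_all add: cblinfun_simps)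
  moreover have "F Y \<in> M" if Y: "Y \<in> M" for Y
  proof -
    have "norm (F Y) \<le> (1/2) * (r + norm (Y o\<^sub>C Y))"
      using norm_triangle_ineq[of A "Y o\<^sub>C Y"] by (simp add: F_def r_def)
    also have "norm (Y o\<^sub>C Y) \<le> norm Y * norm Y"
      by (rule norm_comp_op_le)
    also have "norm Y * norm Y \<le> 1 * r"
      using M_norm[OF Y] r by (intro mult_mono) auto
    finally have "norm (F Y) \<le> r" by simp
    moreover have "(F Y)\<^sup>\<dagger> = F Y"
    proof (rule adj_eqI)
      fix x y
      show "cinner (F Y *\<^sub>V x) y = cinner x (F Y *\<^sub>V y)"
        using M_adj[OF Y] T(2)
        by (simp add: F_def A_def cblinfun_simps cinner_simps cinner_adj scaleR_scaleC)
    qed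
    moreover have "X o\<^sub>C F Y = F Y o\<^sub>C X" if X: "X o\<^sub>C T = T o\<^sub>C X" for X
    proof -
      have "X o\<^sub>C (Y o\<^sub>C Y) = (Y o\<^sub>C Y) o\<^sub>C X"
        using M_comm[OF Y X] by (metis comp_op_assoc)
      thus ?thesis using X by (simp add: F_def A_def comp_op_linear)
    qed
    ultimately show ?thesis by (rule M_I)
  qed
  moreover have "dist (F Y) (F Y') \<le> r * dist Y Y'" if "Y \<in> M" "Y' \<in> M" for Y Y'
  proof -
    have "F Y - F Y' = (1/2) *\<^sub>R (Y o\<^sub>C (Y - Y') + (Y - Y') o\<^sub>C Y')"
      by (simp add: F_def comp_op_linear algebra_simps)
    hence "norm (F Y - F Y') \<le> (1/2) * (norm (Y o\<^sub>C (Y - Y')) + norm ((Y - Y') o\<^sub>C Y'))"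
      using norm_triangle_ineq[of "Y o\<^sub>C (Y - Y')" "(Y - Y') o\<^sub>C Y'"] by simp
    also have "\<dots> \<le> (1/2) * (r * norm (Y - Y') + norm (Y - Y') * r)"
      using that by (intro mult_left_mono add_mono order_trans[OF norm_comp_op_le] mult_right_mono)
        (auto intro: mult_left_mono M_norm)
    finally show ?thesis by (simp add: dist_norm mult.commute)
  qed
  ultimately obtain Y where "Y \<in> M" "F Y = Y"
    using Banach_fix[of M r F] r by blast
  note Y = M_norm[OF \<open>Y \<in> M\<close>] M_adj[OF \<open>Y \<in> M\<close>] M_comm[OF \<open>Y \<in> M\<close>]
  have YY: "Y + Y = A + Y o\<^sub>C Y"
    using arg_cong[OF \<open>F Y = Y\<close>, of "\<lambda>X. 2 *\<^sub>R X"] by (simp add: F_def scaleR_2)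
  define S where "S = (1 / sqrt t) *\<^sub>R (id_op - Y)"
  show thesis
  proof (rule that)
    \<comment> \<open>The fixed point equation reads \<open>2 Y = A + Y\<^sup>2\<close>, hence the
      square of \<open>I - Y\<close> is \<open>I - A = t T\<close>.\<close>
    have "(id_op - Y) o\<^sub>C (id_op - Y) = t *\<^sub>R T"
      using YY by (simp add: comp_op_linear A_def algebra_simps)
    moreover have "S o\<^sub>C S = (1 / t) *\<^sub>R ((id_op - Y) o\<^sub>C (id_op - Y))"
      using t by (simp add: S_def bounded_bilinear.scaleR_left[OF bounded_bilinear_comp_op]
          bounded_bilinear.scaleR_right[OF bounded_bilinear_comp_op])
    ultimately show "S o\<^sub>C S = T"
      using t by simp
    have "(1 - r) / sqrt t * (norm x)\<^sup>2 \<le> inner (S *\<^sub>V x) x" for x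
    proof -
      have "inner (Y *\<^sub>V x) x \<le> norm (Y *\<^sub>V x) * norm x"
        by (rule norm_cauchy_schwarz)
      also have "\<dots> \<le> (norm Y * norm x) * norm x"
        by (intro mult_right_mono norm_cblinfun_apply_le) simp
      also have "\<dots> \<le> r * (norm x)\<^sup>2"
        using Y(1) by (simp add: power2_eq_square mult_right_mono flip: mult.assoc)
      finally have "(1 - r) * (norm x)\<^sup>2 \<le> inner ((id_op - Y) *\<^sub>V x) x"
        by (simp add: cblinfun_simps inner_diff_left power2_norm_eq_inner algebra_simps)
      thus ?thesis
        using t by (simp add: S_def cblinfun_simps divide_right_mono)
    qed
    thus "coercive_op S"
      unfolding coercive_op_def using r t by (intro exI[of _ "(1 - r) / sqrt t"]) simp
    show "S\<^sup>\<dagger> = S"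
      using Y(2) unfolding adj_eq_iff_inner by (simp add: S_def cblinfun_simps inner_simps)
    show "X o\<^sub>C S = S o\<^sub>C X" if "X o\<^sub>C T = T o\<^sub>C X" for X
      using Y(3)[OF that] by (simp add: S_def comp_op_linear)
  qed
qed

lemma coercive_op_positive: "positive_op T" if T: "coercive_op T" "T\<^sup>\<dagger> = T"
proof -
  obtain c where c: "0 < c" "c * (norm x)\<^sup>2 \<le> inner (T *\<^sub>V x) x" for x
    using T by (auto simp: coercive_op_def)
  have "0 \<le> inner (T *\<^sub>V x) x" for x
    by (rule order_trans[OF _ c(2)]) (use c(1) in simp)
  thus ?thesis using T by (simp add: positive_op_iff)
qed

text \<open>A positive root \<open>S'\<close> commutes with its square \<open>T\<close>, hence with
  the constructed root \<open>S\<close>. Then \<open>S + S'\<close> annihilates the range of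
  \<open>S - S'\<close>, and coercivity of \<open>S\<close> makes that range zero, so the
  description in \<open>sqrt_op\<close> is unique.\<close>

theorem sqrt_op:
  assumes "coercive_op T" "T\<^sup>\<dagger> = T"
  shows "sqrt_op T o\<^sub>C sqrt_op T = T" "coercive_op (sqrt_op T)" "(sqrt_op T)\<^sup>\<dagger> = sqrt_op T"
proof -
  obtain S where S: "S o\<^sub>C S = T" "coercive_op S" "S\<^sup>\<dagger> = S"
    "\<And>X. X o\<^sub>C T = T o\<^sub>C X \<Longrightarrow> X o\<^sub>C S = S o\<^sub>C X"
    using sqrt_exists[OF assms] by blast
  have "S' = S" if S': "positive_op S'" "S' o\<^sub>C S' = T" for S'
  proof (rule cblinfun_eqI)
    fix x
    have comm: "S' o\<^sub>C S = S o\<^sub>C S'"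
      using S(4)[of S'] S'(2) by (metis comp_op_assoc)
    define w where "w = (S - S') *\<^sub>V x"
    have "(S + S') o\<^sub>C (S - S') = 0"
      using S(1) S'(2) comm by (simp add: comp_op_linear)
    hence "(S + S') *\<^sub>V w = 0"
      unfolding w_def by (metis comp_op.rep_eq zero_cblinfun.rep_eq)
    hence "inner (S *\<^sub>V w) w + inner (S' *\<^sub>V w) w = 0"
      by (simp add: cblinfun_simps flip: inner_add_left)
    moreover have "0 \<le> inner (S' *\<^sub>V w) w"
      using S'(1) by (simp add: positive_op_iff)
    moreover obtain c where "0 < c" "c * (norm w)\<^sup>2 \<le> inner (S *\<^sub>V w) w"
      using S(2) by (auto simp: coercive_op_def)
    ultimately have "c * (norm w)\<^sup>2 \<le> 0" by linarith
    hence "w = 0" using \<open>0 < c\<close> by (simp add: mult_le_0_iff)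
    thus "S' *\<^sub>V x = S *\<^sub>V x" by (simp add: w_def cblinfun_simps)
  qed
  hence "sqrt_op T = S"
    unfolding sqrt_op_def
    using S(1) coercive_op_positive[OF S(2,3)] by (intro the_equality) blast+
  thus "sqrt_op T o\<^sub>C sqrt_op T = T" "coercive_op (sqrt_op T)" "(sqrt_op T)\<^sup>\<dagger> = sqrt_op T"
    using S(1-3) by simp_all
qed

text \<open>The inverse square root is an isometry from the given norm into the norm weighted by
  \<open>T\<close>. In this way \<open>Q\<close> and \<open>R\<close> turn input energies into plain
  squared norms.\<close>

lemma inner_inv_sqrt_op:
  assumes "coercive_op T" "T\<^sup>\<dagger> = T"
  shows "inner (T *\<^sub>V (inv_op (sqrt_op T) *\<^sub>V x)) (inv_op (sqrt_op T) *\<^sub>V x) = (norm x)\<^sup>2"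
proof -
  note S = sqrt_op[OF assms]
  define g where "g = inv_op (sqrt_op T) *\<^sub>V x"
  have x: "sqrt_op T *\<^sub>V g = x"
    by (simp add: g_def coercive_op_invertible[OF S(2)])
  have "T *\<^sub>V g = sqrt_op T *\<^sub>V x"
    using arg_cong[OF S(1), of "\<lambda>S. S *\<^sub>V g"] by (simp add: comp_op.rep_eq x)
  hence "inner (T *\<^sub>V g) g = inner x (sqrt_op T *\<^sub>V g)"
    by (simp add: inner_adj S(3))
  thus ?thesis
    by (simp add: x power2_norm_eq_inner flip: g_def)
qed

section \<open>Analytic operator functions\<close>

lemma bounded_bilinear_scaleC:
  "bounded_bilinear ((*\<^sub>C) :: complex \<Rightarrow> 'a \<Rightarrow> 'a::complex_normed_vector)"
proof
  fix r :: real and c :: complex and x :: 'a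
  show "(r *\<^sub>R c) *\<^sub>C x = r *\<^sub>R (c *\<^sub>C x)"
    by (simp only: scaleR_scaleC[of r "c *\<^sub>C x"] scaleC_scaleC scaleR_conv_of_real)
  show "\<exists>K. \<forall>c (x :: 'a). norm (c *\<^sub>C x) \<le> norm c * norm x * K"
    by (rule exI[of _ 1]) (simp add: norm_scaleC)
qed (rule scaleC_add_left scaleC_add_right scaleC_scaleR_commute)+

lemma bounded_linear_scaleC_left: "bounded_linear (\<lambda>c. c *\<^sub>C x)"
  by (rule bounded_bilinear.bounded_linear_left[OF bounded_bilinear_scaleC])

text \<open>Difference quotients allow the derivative of an inverse to be computed as a limit of
  operator products.\<close>

lemma has_derivative_scaleC_iff:
  fixes f :: "complex \<Rightarrow> 'a::complex_normed_vector"
  shows "(f has_derivative (\<lambda>h. h *\<^sub>C d)) (at z) \<longleftrightarrow>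
    ((\<lambda>w. inverse (w - z) *\<^sub>C (f w - f z)) \<longlongrightarrow> d) (at z)"
proof -
  have "\<forall>\<^sub>F w in at z. norm ((f w - f z) - (w - z) *\<^sub>C d) / norm (w - z)
      = norm (inverse (w - z) *\<^sub>C (f w - f z) - d)"
    unfolding eventually_at_filter
  proof (intro always_eventually allI impI)
    fix w assume "w \<noteq> z"
    hence "inverse (w - z) *\<^sub>C (f w - f z) - d
        = inverse (w - z) *\<^sub>C ((f w - f z) - (w - z) *\<^sub>C d)"
      by (simp add: scaleC_diff_right scaleC_scaleC scaleC_one)
    thus "norm ((f w - f z) - (w - z) *\<^sub>C d) / norm (w - z)
        = norm (inverse (w - z) *\<^sub>C (f w - f z) - d)"
      by (simp add: norm_scaleC norm_inverse divide_inverse mult.commute)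
  qed
  hence "((\<lambda>w. norm ((f w - f z) - (w - z) *\<^sub>C d) / norm (w - z)) \<longlongrightarrow> 0) (at z) \<longleftrightarrow>
      ((\<lambda>w. norm (inverse (w - z) *\<^sub>C (f w - f z) - d)) \<longlongrightarrow> 0) (at z)"
    by (rule tendsto_cong)
  also have "\<dots> \<longleftrightarrow> ((\<lambda>w. inverse (w - z) *\<^sub>C (f w - f z)) \<longlongrightarrow> d) (at z)"
    by (simp add: tendsto_norm_zero_iff LIM_zero_iff)
  finally show ?thesis
    unfolding has_derivative_iff_norm by (simp add: bounded_linear_scaleC_left)
qed

lemma analytic_on_disc_const: "analytic_on_disc (\<lambda>z. c)"
proof -
  have "((\<lambda>z. c) has_derivative (\<lambda>h. h *\<^sub>C 0)) (at z)" for z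
    by simp
  thus ?thesis unfolding analytic_on_disc_def by blast
qed

lemma analytic_on_disc_add: "analytic_on_disc (\<lambda>z. f z + g z)"
  if fg: "analytic_on_disc f" "analytic_on_disc g"
  unfolding analytic_on_disc_def
proof
  fix z :: complex assume "z \<in> ball 0 1"
  then obtain d e where "(f has_derivative (\<lambda>h. h *\<^sub>C d)) (at z)" "(g has_derivative (\<lambda>h. h *\<^sub>C e)) (at z)"
    using fg unfolding analytic_on_disc_def by blast
  hence "((\<lambda>z. f z + g z) has_derivative (\<lambda>h. h *\<^sub>C (d + e))) (at z)"
    unfolding scaleC_add_right by (rule has_derivative_add)
  thus "\<exists>d. ((\<lambda>z. f z + g z) has_derivative (\<lambda>h. h *\<^sub>C d)) (at z)" ..
qed

lemma analytic_on_disc_scaleC: "analytic_on_disc (\<lambda>z. z *\<^sub>C f z)" if f: "analytic_on_disc f"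
  unfolding analytic_on_disc_def
proof
  fix z :: complex assume "z \<in> ball 0 1"
  then obtain d where "(f has_derivative (\<lambda>h. h *\<^sub>C d)) (at z)"
    using f unfolding analytic_on_disc_def by blast
  from bounded_bilinear.FDERIV[OF bounded_bilinear_scaleC has_derivative_ident this]
  have "((\<lambda>z. z *\<^sub>C f z) has_derivative (\<lambda>h. h *\<^sub>C (z *\<^sub>C d + f z))) (at z)"
    by (simp add: scaleC_add_right scaleC_scaleC mult.commute)
  thus "\<exists>d. ((\<lambda>z. z *\<^sub>C f z) has_derivative (\<lambda>h. h *\<^sub>C d)) (at z)" ..
qed

lemma analytic_on_disc_linear: "analytic_on_disc (\<lambda>z. L (f z))"
  if f: "analytic_on_disc f" and L: "bounded_linear L" "\<And>c x. L (c *\<^sub>C x) = c *\<^sub>C L x"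
  unfolding analytic_on_disc_def
proof
  fix z :: complex assume "z \<in> ball 0 1"
  then obtain d where "(f has_derivative (\<lambda>h. h *\<^sub>C d)) (at z)"
    using f unfolding analytic_on_disc_def by blast
  from bounded_linear.has_derivative[OF L(1) this]
  have "((\<lambda>z. L (f z)) has_derivative (\<lambda>h. h *\<^sub>C L d)) (at z)"
    by (simp add: L(2))
  thus "\<exists>d. ((\<lambda>z. L (f z)) has_derivative (\<lambda>h. h *\<^sub>C d)) (at z)" ..
qed

lemma analytic_on_disc_comp_left: "analytic_on_disc (\<lambda>z. S o\<^sub>C f z)" if "analytic_on_disc f"
  using that bounded_bilinear.bounded_linear_right[OF bounded_bilinear_comp_op] comp_op_scaleC(2)
  by (rule analytic_on_disc_linear)

lemma analytic_on_disc_comp_right: "analytic_on_disc (\<lambda>z. f z o\<^sub>C S)" if "analytic_on_disc f"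
  using that bounded_bilinear.bounded_linear_left[OF bounded_bilinear_comp_op] comp_op_scaleC(1)
  by (rule analytic_on_disc_linear)

lemma analytic_on_disc_apply: "analytic_on_disc (\<lambda>z. f z *\<^sub>V x)" if "analytic_on_disc f"
  by (rule analytic_on_disc_linear[OF that bounded_linear_eval]) (simp add: cblinfun_simps)

lemma inv_op_diff: "inv_op S - inv_op T = inv_op S o\<^sub>C (T - S) o\<^sub>C inv_op T"
  if "invertible_op S" "invertible_op T"
  by (rule cblinfun_eqI) (simp add: cblinfun_simps that)

lemma analytic_on_disc_continuous: "isCont f z" if "analytic_on_disc f" "z \<in> ball 0 1"
  using that has_derivative_continuous unfolding analytic_on_disc_def by blast

text \<open>The identity \<open>G w - G z = G w o\<^sub>C (F z - F w) o\<^sub>C G z\<close> gives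
  first the continuity of the inverse \<open>G\<close>, then its derivative, by dividing by
  \<open>w - z\<close>.\<close>

theorem analytic_on_disc_inv_op:
  assumes F: "analytic_on_disc F" and inv: "\<And>z. z \<in> ball 0 1 \<Longrightarrow> invertible_op (F z)"
  shows "analytic_on_disc (\<lambda>z. inv_op (F z))"
  unfolding analytic_on_disc_def
proof
  fix z :: complex assume z: "z \<in> ball 0 1"
  obtain d where d: "((\<lambda>w. inverse (w - z) *\<^sub>C (F w - F z)) \<longlongrightarrow> d) (at z)"
    using F z unfolding analytic_on_disc_def has_derivative_scaleC_iff by blast
  define G where "G w = inv_op (F w)" for w
  define K where "K = norm (G z)"
  have Flim: "(F \<longlongrightarrow> F z) (at z)"
    using analytic_on_disc_continuous[OF F z] by (simp add: isCont_def)
  have ball: "\<forall>\<^sub>F w in at z. w \<in> ball 0 1"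
    using z by (intro eventually_at_in_open') simp_all
  have diff: "G w - G z = G w o\<^sub>C (F z - F w) o\<^sub>C G z" if "w \<in> ball 0 1" for w
    unfolding G_def using inv_op_diff[OF inv[OF that] inv[OF z]] .
  have Flim0: "((\<lambda>w. norm (F z - F w) * K) \<longlongrightarrow> 0) (at z)"
    using Flim by (auto intro!: tendsto_eq_intros)
  have norm_diff: "norm (G w - G z) \<le> norm (G w) * (norm (F z - F w) * K)" if "w \<in> ball 0 1" for w
  proof -
    have "norm (G w o\<^sub>C (F z - F w) o\<^sub>C G z) \<le> norm (G w o\<^sub>C (F z - F w)) * K"
      unfolding K_def by (rule norm_comp_op_le)
    also have "\<dots> \<le> (norm (G w) * norm (F z - F w)) * K"
      by (intro mult_right_mono norm_comp_op_le) (simp add: K_def)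
    finally show ?thesis by (simp add: diff[OF that] mult.assoc)
  qed
  \<comment> \<open>No bound on \<open>G w\<close> is known beforehand. Once
    \<open>norm (F z - F w) * K\<close> is below 1/2, half of \<open>norm (G w)\<close> can be
    absorbed, leaving \<open>norm (G w) \<le> 2 * K\<close>.\<close>
  have "\<forall>\<^sub>F w in at z. norm (G w - G z) \<le> 2 * K * (norm (F z - F w) * K)"
    using order_tendstoD(2)[OF Flim0, of "1/2", simplified] ball
  proof eventually_elim
    case (elim w)
    have "norm (G w) \<le> K + norm (G w - G z)"
      using norm_triangle_ineq[of "G z" "G w - G z"] by (simp add: K_def)
    also have "\<dots> \<le> K + norm (G w) * (1/2)"
      using norm_diff[OF elim(2)] elim(1)
        mult_left_mono[of "norm (F z - F w) * K" "1/2" "norm (G w)"] by simp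
    finally have "norm (G w) \<le> 2 * K" by simp
    hence "norm (G w) * (norm (F z - F w) * K) \<le> 2 * K * (norm (F z - F w) * K)"
      by (rule mult_right_mono) (simp add: K_def)
    with norm_diff[OF elim(2)] show ?case by linarith
  qed
  moreover have "((\<lambda>w. 2 * K * (norm (F z - F w) * K)) \<longlongrightarrow> 0) (at z)"
    using tendsto_mult_left[OF Flim0, of "2 * K"] by simp
  ultimately have "((\<lambda>w. G w - G z) \<longlongrightarrow> 0) (at z)"
    by (rule Lim_null_comparison)
  hence G: "(G \<longlongrightarrow> G z) (at z)" by (rule LIM_zero_cancel)
  have "((\<lambda>w. - (G w o\<^sub>C (inverse (w - z) *\<^sub>C (F w - F z)) o\<^sub>C G z)) \<longlongrightarrow> - (G z o\<^sub>C d o\<^sub>C G z)) (at z)"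
    by (intro tendsto_intros bounded_bilinear.tendsto[OF bounded_bilinear_comp_op] G d)
  moreover have "\<forall>\<^sub>F w in at z. - (G w o\<^sub>C (inverse (w - z) *\<^sub>C (F w - F z)) o\<^sub>C G z)
      = inverse (w - z) *\<^sub>C (G w - G z)"
    using ball
  proof eventually_elim
    case (elim w)
    show ?case
      unfolding diff[OF elim]
      by (rule cblinfun_eqI) (simp add: cblinfun_simps scaleC_diff_right)
  qed
  ultimately have "((\<lambda>w. inverse (w - z) *\<^sub>C (G w - G z)) \<longlongrightarrow> - (G z o\<^sub>C d o\<^sub>C G z)) (at z)"
    by (rule Lim_transform_eventually)
  thus "\<exists>d. ((\<lambda>z. inv_op (F z)) has_derivative (\<lambda>h. h *\<^sub>C d)) (at z)"
    unfolding G_def has_derivative_scaleC_iff by blast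
qed

section \<open>Power bounded operators\<close>

lemma adj_op_power: "(op_power T n)\<^sup>\<dagger> = op_power (T\<^sup>\<dagger>) n"
proof (induction n)
  case (Suc n)
  thus ?case
    unfolding op_power_Suc_right[of "T\<^sup>\<dagger>"] by (simp add: adj_comp)
qed simp

definition power_bounded :: "('a::complex_normed_vector \<rightarrow>\<^sub>C 'a) \<Rightarrow> bool"
  where "power_bounded T \<longleftrightarrow> (\<exists>M. \<forall>n. norm (op_power T n) \<le> M)"

text \<open>Bounded powers give the geometric majorant \<open>M * cmod z ^ n\<close>, so the Neumann
  series converges on the whole disc.\<close>

lemma power_bounded_resolvent:
  fixes T :: "'a::chilbert_space \<rightarrow>\<^sub>C 'a"
  assumes "power_bounded T" "z \<in> ball 0 1"
  shows "invertible_op (id_op - z *\<^sub>C T)"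
    and "(\<lambda>n. z ^ n *\<^sub>C op_power T n) sums inv_op (id_op - z *\<^sub>C T)"
proof -
  obtain M where M: "norm (op_power T n) \<le> M" for n
    using assms(1) by (auto simp: power_bounded_def)
  have *: "summable (\<lambda>n. norm (op_power (z *\<^sub>C T) n))"
  proof (rule summable_comparison_test'[of "\<lambda>n. M * cmod z ^ n" 0])
    show "summable (\<lambda>n. M * cmod z ^ n)"
      using assms(2) by (intro summable_mult summable_geometric) simp
    show "norm (norm (op_power (z *\<^sub>C T) n)) \<le> M * cmod z ^ n" for n
      using mult_right_mono[OF M, of "cmod z ^ n" n]
      by (simp add: op_power_scaleC norm_scaleC norm_power mult.commute)
  qed
  show "invertible_op (id_op - z *\<^sub>C T)"
    by (rule neumann_series(1)[OF *])
  show "(\<lambda>n. z ^ n *\<^sub>C op_power T n) sums inv_op (id_op - z *\<^sub>C T)"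
    using neumann_series(2)[OF *] unfolding ext[of "op_power (z *\<^sub>C T)", OF op_power_scaleC] .
qed

lemma analytic_on_disc_resolvent:
  fixes T :: "'a::chilbert_space \<rightarrow>\<^sub>C 'a"
  assumes "power_bounded T"
  shows "analytic_on_disc (\<lambda>z. inv_op (id_op - z *\<^sub>C T))"
proof (rule analytic_on_disc_inv_op)
  show "analytic_on_disc (\<lambda>z. id_op - z *\<^sub>C T)"
    using analytic_on_disc_add[OF analytic_on_disc_const[of id_op]
        analytic_on_disc_scaleC[OF analytic_on_disc_const[of "- T"]]]
    by (simp add: scaleC_minus_right)
qed (rule power_bounded_resolvent(1)[OF assms])

section \<open>Hardy space functions of the interpolation data\<close>

lemma ell2_nth_power_shift:
  "ell2_nth (op_power shift_op n *\<^sub>V (embed_op *\<^sub>V v)) m = (if m = n then v else 0)"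
proof (induction n arbitrary: m)
  case 0
  show ?case by (simp add: cblinfun_simps embed_op.rep_eq embed_ell2.rep_eq)
next
  case (Suc n)
  show ?case by (cases m) (simp_all add: cblinfun_simps shift_op.rep_eq shift_ell2.rep_eq Suc)
qed

text \<open>The adjoint of \<open>S\<^sup>n E\<close> is the n-th coordinate map; through it the
  intertwining relation determines the entries of \<open>W\<^sup>* x\<close>.\<close>

lemma cinner_power_shift:
  "cinner (op_power shift_op n *\<^sub>V (embed_op *\<^sub>V v)) y = cinner v (ell2_nth y n)"
proof -
  have "(\<lambda>m. cinner (ell2_nth (op_power shift_op n *\<^sub>V (embed_op *\<^sub>V v)) m) (ell2_nth y m))
      = (\<lambda>m. if m = n then cinner v (ell2_nth y m) else 0)"
    by (auto simp: ell2_nth_power_shift)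
  thus ?thesis
    using sums_single[of n "\<lambda>m. cinner v (ell2_nth y m)"]
    by (simp add: cinner_ell2.rep_eq sums_iff)
qed

lemma op_power_intertwine: "op_power Z n o\<^sub>C W = W o\<^sub>C op_power S n" if "Z o\<^sub>C W = W o\<^sub>C S"
proof (induction n)
  case (Suc n)
  have "op_power Z (Suc n) o\<^sub>C W = Z o\<^sub>C W o\<^sub>C op_power S n"
    by (simp add: comp_op_assoc Suc)
  thus ?case
    by (simp add: that comp_op_assoc)
qed simp

lemma hardy_H2I:
  assumes "analytic_on_disc f" "\<And>z. z \<in> ball 0 1 \<Longrightarrow> (\<lambda>n. z ^ n *\<^sub>C a n) sums f z"
    "summable (\<lambda>n. (norm (a n))\<^sup>2)"
  shows "f \<in> hardy_H2"
  using assms unfolding hardy_H2_def by blast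

context
  fixes Z :: "'z::chilbert_space \<rightarrow>\<^sub>C 'z" and W :: "'y::chilbert_space ell2 \<rightarrow>\<^sub>C 'z"
  assumes ZW: "Z o\<^sub>C W = W o\<^sub>C shift_op"
begin

text \<open>\<open>W\<^sup>*\<close> is the observability operator of the pair \<open>(B\<^sup>*, Z\<^sup>*)\<close>, where \<open>B = W E\<close>.\<close>

lemma ell2_nth_adj:
  "ell2_nth (W\<^sup>\<dagger> *\<^sub>V x) n = (W o\<^sub>C embed_op)\<^sup>\<dagger> *\<^sub>V (op_power (Z\<^sup>\<dagger>) n *\<^sub>V x)"
proof (rule cinner_right_eqI)
  fix v
  have "cinner v (ell2_nth (W\<^sup>\<dagger> *\<^sub>V x) n) = cinner ((W o\<^sub>C op_power shift_op n) *\<^sub>V (embed_op *\<^sub>V v)) x"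
    by (simp add: cblinfun_simps cinner_adj flip: cinner_power_shift)
  also have "\<dots> = cinner v ((W o\<^sub>C embed_op)\<^sup>\<dagger> *\<^sub>V (op_power (Z\<^sup>\<dagger>) n *\<^sub>V x))"
    by (simp add: cblinfun_simps cinner_adj adj_comp adj_op_power flip: op_power_intertwine[OF ZW])
  finally show "cinner v (ell2_nth (W\<^sup>\<dagger> *\<^sub>V x) n)
      = cinner v ((W o\<^sub>C embed_op)\<^sup>\<dagger> *\<^sub>V (op_power (Z\<^sup>\<dagger>) n *\<^sub>V x))" .
qed

text \<open>Passing from \<open>x\<close> to \<open>Z\<^sup>* x\<close> deletes the first entry of
  \<open>W\<^sup>* x\<close>, and the deleted entry is \<open>B\<^sup>* x\<close>. The difference of
  this identity for \<open>W\<close> and for \<open>Wt\<close> is the Stein equation of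
  \<open>\<Lambda>\<close>.\<close>

lemma norm_adj_stein:
  "(norm (W\<^sup>\<dagger> *\<^sub>V x))\<^sup>2 = (norm (W\<^sup>\<dagger> *\<^sub>V (Z\<^sup>\<dagger> *\<^sub>V x)))\<^sup>2 + (norm ((W o\<^sub>C embed_op)\<^sup>\<dagger> *\<^sub>V x))\<^sup>2"
proof -
  have "op_power (Z\<^sup>\<dagger>) n *\<^sub>V (Z\<^sup>\<dagger> *\<^sub>V x) = op_power (Z\<^sup>\<dagger>) (Suc n) *\<^sub>V x" for n
    unfolding op_power_Suc_right by (simp add: cblinfun_simps)
  hence "ell2_nth (W\<^sup>\<dagger> *\<^sub>V (Z\<^sup>\<dagger> *\<^sub>V x)) n = ell2_nth (W\<^sup>\<dagger> *\<^sub>V x) (Suc n)" for n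
    by (simp add: ell2_nth_adj)
  hence "(\<lambda>n. (norm (ell2_nth (W\<^sup>\<dagger> *\<^sub>V x) (Suc n)))\<^sup>2) sums (norm (W\<^sup>\<dagger> *\<^sub>V (Z\<^sup>\<dagger> *\<^sub>V x)))\<^sup>2"
    using norm_ell2_sums[of "W\<^sup>\<dagger> *\<^sub>V (Z\<^sup>\<dagger> *\<^sub>V x)"] by simp
  from sums_Suc[OF this] have "(\<lambda>n. (norm (ell2_nth (W\<^sup>\<dagger> *\<^sub>V x) n))\<^sup>2) sums
      ((norm (W\<^sup>\<dagger> *\<^sub>V (Z\<^sup>\<dagger> *\<^sub>V x)))\<^sup>2 + (norm ((W o\<^sub>C embed_op)\<^sup>\<dagger> *\<^sub>V x))\<^sup>2)"
    by (simp add: ell2_nth_adj[of x 0] cblinfun_simps)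
  with norm_ell2_sums show ?thesis by (rule sums_unique2)
qed

text \<open>As \<open>W\<close> is right invertible, \<open>Z\<^sup>n = W S\<^sup>n W\<^sup>* P\<^sup>-\<^sup>1\<close> with \<open>P = W W\<^sup>*\<close>.\<close>

lemma power_bounded_adj:
  assumes P: "invertible_op (W o\<^sub>C W\<^sup>\<dagger>)"
  shows "power_bounded (Z\<^sup>\<dagger>)"
proof -
  define V where "V = W\<^sup>\<dagger> o\<^sub>C inv_op (W o\<^sub>C W\<^sup>\<dagger>)"
  have "norm (op_power (Z\<^sup>\<dagger>) n) \<le> norm W * norm V" for n
  proof -
    have "op_power Z n = op_power Z n o\<^sub>C (W o\<^sub>C V)"
      using inv_op(2)[OF P] by (simp add: V_def flip: comp_op_assoc)
    also have "\<dots> = W o\<^sub>C op_power shift_op n o\<^sub>C V"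
      by (simp add: op_power_intertwine[OF ZW] flip: comp_op_assoc)
    finally have eq: "op_power Z n = W o\<^sub>C op_power shift_op n o\<^sub>C V" .
    have "norm (shift_op :: 'y ell2 \<rightarrow>\<^sub>C 'y ell2) \<le> 1"
      by (rule norm_cblinfun_leI) (simp_all add: shift_op.rep_eq norm_shift_ell2)
    hence "norm (op_power shift_op n :: 'y ell2 \<rightarrow>\<^sub>C 'y ell2) \<le> 1"
      using norm_op_power_le power_le_one order_trans norm_ge_zero by metis
    have "norm (op_power (Z\<^sup>\<dagger>) n) \<le> norm (op_power Z n)"
      using norm_adj_le[of "op_power Z n"] by (simp add: adj_op_power)
    also have "\<dots> \<le> norm (W o\<^sub>C op_power shift_op n) * norm V"
      unfolding eq by (rule norm_comp_op_le)
    also have "\<dots> \<le> (norm W * norm (op_power shift_op n :: 'y ell2 \<rightarrow>\<^sub>C 'y ell2)) * norm V"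
      by (intro mult_right_mono norm_comp_op_le) simp
    also have "\<dots> \<le> (norm W * 1) * norm V"
      by (intro mult_right_mono mult_left_mono) (simp_all add: \<open>norm (op_power shift_op n) \<le> 1\<close>)
    finally show ?thesis by simp
  qed
  thus ?thesis by (auto simp: power_bounded_def)
qed

text \<open>The Neumann series has the entries of \<open>W\<^sup>* x\<close> as Taylor coefficients.
  Power boundedness is a separate hypothesis because the lemma also serves \<open>Wt\<close>, for
  which \<open>Wt o\<^sub>C Wt\<^sup>\<dagger>\<close> may fail to be invertible.\<close>

lemma hardy_H2_observability:
  assumes "power_bounded (Z\<^sup>\<dagger>)"
  shows "(\<lambda>z. (W o\<^sub>C embed_op)\<^sup>\<dagger> *\<^sub>V (inv_op (id_op - z *\<^sub>C Z\<^sup>\<dagger>) *\<^sub>V x)) \<in> hardy_H2"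
proof -
  define B where "B = W o\<^sub>C embed_op"
  have "analytic_on_disc (\<lambda>z. B\<^sup>\<dagger> *\<^sub>V (inv_op (id_op - z *\<^sub>C Z\<^sup>\<dagger>) *\<^sub>V x))"
    using analytic_on_disc_apply[OF analytic_on_disc_resolvent[OF assms]]
    by (rule analytic_on_disc_linear) (simp_all add: bounded_linear_cblinfun_apply cblinfun_simps)
  moreover have "(\<lambda>n. z ^ n *\<^sub>C ell2_nth (W\<^sup>\<dagger> *\<^sub>V x) n) sums (B\<^sup>\<dagger> *\<^sub>V (inv_op (id_op - z *\<^sub>C Z\<^sup>\<dagger>) *\<^sub>V x))"
    if "z \<in> ball 0 1" for z
    using bounded_linear.sums[OF bounded_linear_cblinfun_apply[of "B\<^sup>\<dagger>"]
        bounded_linear.sums[OF bounded_linear_eval power_bounded_resolvent(2)[OF assms that], of x]]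
    by (simp add: ell2_nth_adj B_def cblinfun_simps)
  ultimately show ?thesis
    unfolding B_def using norm_ell2_sums[of "W\<^sup>\<dagger> *\<^sub>V x"] by (intro hardy_H2I sums_summable)
qed

end

lemma hardy_H2_const: "(\<lambda>z. c) \<in> hardy_H2"
proof -
  have "(\<lambda>n. z ^ n *\<^sub>C (if n = 0 then c else 0)) sums c" for z
  proof -
    have "(\<lambda>n. z ^ n *\<^sub>C (if n = 0 then c else 0)) = (\<lambda>n. if n = 0 then c else 0)"
      by (auto simp: scaleC_one)
    thus ?thesis using sums_single[of 0 "\<lambda>n. c"] by simp
  qed
  moreover have "summable (\<lambda>n. (norm (if n = (0::nat) then c else 0))\<^sup>2)"
    by (rule summable_finite[of "{0}"]) auto
  ultimately show ?thesis
    by (intro hardy_H2I analytic_on_disc_const)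
qed

lemma hardy_H2_add: "(\<lambda>z. f z + g z) \<in> hardy_H2" if "f \<in> hardy_H2" "g \<in> hardy_H2"
proof -
  obtain a b where
    a: "\<forall>z\<in>ball 0 1. (\<lambda>n. z ^ n *\<^sub>C a n) sums f z" "summable (\<lambda>n. (norm (a n))\<^sup>2)" and
    b: "\<forall>z\<in>ball 0 1. (\<lambda>n. z ^ n *\<^sub>C b n) sums g z" "summable (\<lambda>n. (norm (b n))\<^sup>2)"
    using \<open>f \<in> hardy_H2\<close> \<open>g \<in> hardy_H2\<close> unfolding hardy_H2_def by blast
  have "(\<lambda>n. z ^ n *\<^sub>C (a n + b n)) sums (f z + g z)" if "z \<in> ball 0 1" for z
    using a(1) b(1) that by (simp add: scaleC_add_right sums_add)
  moreover have "summable (\<lambda>n. (norm (a n + b n))\<^sup>2)"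
    by (rule summable_sq_add[OF a(2) b(2)])
  moreover have "analytic_on_disc (\<lambda>z. f z + g z)"
    using \<open>f \<in> hardy_H2\<close> \<open>g \<in> hardy_H2\<close> by (simp add: hardy_H2_def analytic_on_disc_add)
  ultimately show ?thesis
    by (intro hardy_H2I)
qed

lemma hardy_H2_scaleC: "(\<lambda>z. z *\<^sub>C f z) \<in> hardy_H2" if "f \<in> hardy_H2"
proof -
  obtain a where a: "\<forall>z\<in>ball 0 1. (\<lambda>n. z ^ n *\<^sub>C a n) sums f z" "summable (\<lambda>n. (norm (a n))\<^sup>2)"
    using \<open>f \<in> hardy_H2\<close> unfolding hardy_H2_def by blast
  define b where "b n = (case n of 0 \<Rightarrow> 0 | Suc m \<Rightarrow> a m)" for n
  have "(\<lambda>n. z ^ n *\<^sub>C b n) sums (z *\<^sub>C f z)" if "z \<in> ball 0 1" for z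
  proof -
    have "(\<lambda>n. z ^ Suc n *\<^sub>C b (Suc n)) sums (z *\<^sub>C f z)"
      using bounded_linear.sums[OF bounded_linear_scaleC bspec[OF a(1) that], of z]
      by (simp add: b_def scaleC_scaleC)
    from sums_Suc[OF this] show ?thesis by (simp add: b_def)
  qed
  moreover have "summable (\<lambda>n. (norm (b n))\<^sup>2)"
    by (subst summable_Suc_iff[symmetric]) (simp add: b_def a(2))
  moreover have "analytic_on_disc (\<lambda>z. z *\<^sub>C f z)"
    using \<open>f \<in> hardy_H2\<close> by (simp add: hardy_H2_def analytic_on_disc_scaleC)
  ultimately show ?thesis
    by (intro hardy_H2I)
qed

lemma norm_inv_op_le_one:
  assumes "invertible_op T" "\<And>u. norm u \<le> norm (T *\<^sub>V u)"
  shows "norm (inv_op T) \<le> 1"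
proof (rule norm_cblinfun_leI)
  show "norm (inv_op T *\<^sub>V y) \<le> 1 * norm y" for y
    using assms(2)[of "inv_op T *\<^sub>V y"] by (simp add: assms(1))
qed simp

text \<open>The lower bound makes invertibility an open and closed condition along the connected disc.\<close>

lemma invertible_op_on_disc:
  fixes F :: "complex \<Rightarrow> 'a::chilbert_space \<rightarrow>\<^sub>C 'b::chilbert_space"
  assumes F: "analytic_on_disc F" and F0: "invertible_op (F 0)"
    and below: "\<And>z u. z \<in> ball 0 1 \<Longrightarrow> norm u \<le> norm (F z *\<^sub>V u)"
    and z: "z \<in> ball 0 1"
  shows "invertible_op (F z)"
proof -
  \<comment> \<open>The lower bound makes every existing inverse a contraction, so distance 1 is
    admissible at all points and the roles of \<open>a\<close> and \<open>b\<close> can be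
    exchanged.\<close>
  have near: "invertible_op (F b)" if "invertible_op (F a)" "a \<in> ball 0 1" "norm (F a - F b) < 1" for a b
  proof (rule invertible_op_near[OF that(1)])
    have "norm (inv_op (F a)) * norm (F a - F b) \<le> 1 * norm (F a - F b)"
      using norm_inv_op_le_one[OF that(1) below[OF that(2)]] by (rule mult_right_mono) simp
    also have "\<dots> < 1" using that(3) by simp
    finally show "norm (inv_op (F a)) * norm (F a - F b) < 1" .
  qed
  have "invertible_op (F 0) = invertible_op (F z)"
  proof (rule connected_local_const[of "ball 0 1" _ _ "\<lambda>z. invertible_op (F z)"])
    show "\<forall>a\<in>ball 0 1. \<forall>\<^sub>F b in at a within ball 0 1. invertible_op (F a) = invertible_op (F b)"
    proof
      fix a :: complex assume a: "a \<in> ball 0 1"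
      have "(F \<longlongrightarrow> F a) (at a within ball 0 1)"
        using analytic_on_disc_continuous[OF F a] by (simp add: isCont_def Lim_at_imp_Lim_at_within)
      hence "\<forall>\<^sub>F b in at a within ball 0 1. dist (F b) (F a) < 1"
        by (rule tendstoD) simp
      moreover have "\<forall>\<^sub>F b in at a within ball 0 1. b \<in> ball 0 1"
        by (simp add: eventually_at_filter)
      ultimately show "\<forall>\<^sub>F b in at a within ball 0 1. invertible_op (F a) = invertible_op (F b)"
      proof eventually_elim
        case (elim b)
        thus ?case
          using near[of a b] near[of b a] a by (auto simp: dist_norm norm_minus_commute)
      qed
    qed
  qed (use z in simp_all)
  thus ?thesis using F0 by simp
qed

section \<open>Energy balance\<close>

text \<open>Energy balance of a system with state operator \<open>Z\<^sup>*\<close>: the vectors \<open>x = w - h\<close> and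
  \<open>Z\<^sup>* w + \<Lambda>\<^sup>-\<^sup>1 X g\<close> are consecutive states, \<open>(e, u)\<close> with \<open>e = Q\<^sup>-\<^sup>1 g\<close> and \<open>u = R\<^sup>-\<^sup>1 v\<close> is the
  input, and \<open>(B\<^sup>* w + D\<^sup>* g, Bt\<^sup>* w + v)\<close> is the output.\<close>

lemma energy_balance:
  fixes \<Lambda> Z :: "'z::chilbert_space \<rightarrow>\<^sub>C 'z" and B :: "'y::chilbert_space \<rightarrow>\<^sub>C 'z"
    and Bt :: "'u::chilbert_space \<rightarrow>\<^sub>C 'z" and X :: "'e::chilbert_space \<rightarrow>\<^sub>C 'z" and D :: "'y \<rightarrow>\<^sub>C 'e"
  assumes \<Lambda>: "\<Lambda>\<^sup>\<dagger> = \<Lambda>" "invertible_op \<Lambda>"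
    and stein: "\<And>x. inner (\<Lambda> *\<^sub>V (Z\<^sup>\<dagger> *\<^sub>V x)) (Z\<^sup>\<dagger> *\<^sub>V x) + (norm (B\<^sup>\<dagger> *\<^sub>V x))\<^sup>2 - (norm (Bt\<^sup>\<dagger> *\<^sub>V x))\<^sup>2
      = inner (\<Lambda> *\<^sub>V x) x"
    and orth: "\<And>g. Z *\<^sub>V (X *\<^sub>V g) + B *\<^sub>V (D\<^sup>\<dagger> *\<^sub>V g) = 0"
    and h: "\<Lambda> *\<^sub>V h = Bt *\<^sub>V v"
    and \<xi>: "\<xi> = Z\<^sup>\<dagger> *\<^sub>V w + inv_op \<Lambda> *\<^sub>V (X *\<^sub>V g)"
  shows "inner (\<Lambda> *\<^sub>V \<xi>) \<xi> + (norm (B\<^sup>\<dagger> *\<^sub>V w + D\<^sup>\<dagger> *\<^sub>V g))\<^sup>2 - (norm (Bt\<^sup>\<dagger> *\<^sub>V w + v))\<^sup>2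
    = inner (\<Lambda> *\<^sub>V (w - h)) (w - h) + (inner (inv_op \<Lambda> *\<^sub>V (X *\<^sub>V g)) (X *\<^sub>V g) + (norm (D\<^sup>\<dagger> *\<^sub>V g))\<^sup>2)
      - (inner (Bt *\<^sub>V v) h + (norm v)\<^sup>2)"
proof -
  define a where "a = inv_op \<Lambda> *\<^sub>V (X *\<^sub>V g)"
  have a: "\<Lambda> *\<^sub>V a = X *\<^sub>V g" by (simp add: a_def \<Lambda>)
  have sym: "inner (\<Lambda> *\<^sub>V p) q = inner (\<Lambda> *\<^sub>V q) p" for p q
    using inner_adj[of \<Lambda> p q] by (simp add: \<Lambda> inner_commute)
  have "inner (\<Lambda> *\<^sub>V \<xi>) \<xi> = inner (\<Lambda> *\<^sub>V (Z\<^sup>\<dagger> *\<^sub>V w)) (Z\<^sup>\<dagger> *\<^sub>V w)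
      + 2 * inner (X *\<^sub>V g) (Z\<^sup>\<dagger> *\<^sub>V w) + inner (X *\<^sub>V g) a"
    using sym[of "Z\<^sup>\<dagger> *\<^sub>V w" a]
    by (simp add: \<xi> a cblinfun_simps inner_add_left inner_add_right flip: a_def)
  moreover have "(norm (B\<^sup>\<dagger> *\<^sub>V w + D\<^sup>\<dagger> *\<^sub>V g))\<^sup>2
      = (norm (B\<^sup>\<dagger> *\<^sub>V w))\<^sup>2 + 2 * inner (B *\<^sub>V (D\<^sup>\<dagger> *\<^sub>V g)) w + (norm (D\<^sup>\<dagger> *\<^sub>V g))\<^sup>2"
    using inner_adj[of B "D\<^sup>\<dagger> *\<^sub>V g" w] unfolding power2_norm_eq_inner
    by (simp add: inner_add_left inner_add_right inner_commute)
  moreover have "(norm (Bt\<^sup>\<dagger> *\<^sub>V w + v))\<^sup>2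
      = (norm (Bt\<^sup>\<dagger> *\<^sub>V w))\<^sup>2 + 2 * inner (Bt *\<^sub>V v) w + (norm v)\<^sup>2"
    using inner_adj[of Bt v w] unfolding power2_norm_eq_inner
    by (simp add: inner_add_left inner_add_right inner_commute)
  \<comment> \<open>Since \<open>\<Lambda> h = Bt v\<close>, the mixed term matches the one from the
    second output.\<close>
  moreover have "inner (\<Lambda> *\<^sub>V (w - h)) (w - h)
      = inner (\<Lambda> *\<^sub>V w) w - 2 * inner (Bt *\<^sub>V v) w + inner (Bt *\<^sub>V v) h"
    using sym[of w h] by (simp add: cblinfun_simps h inner_diff_left inner_diff_right)
  \<comment> \<open>The orthogonality relation cancels the mixed terms in \<open>g\<close> and
    \<open>w\<close> coming from the state and the first output.\<close>
  moreover have "inner (X *\<^sub>V g) (Z\<^sup>\<dagger> *\<^sub>V w) + inner (B *\<^sub>V (D\<^sup>\<dagger> *\<^sub>V g)) w = 0"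
    using orth[of g] by (simp flip: inner_adj inner_add_left)
  ultimately show ?thesis
    using stein[of w] by (simp add: inner_commute flip: a_def)
qed

lemma cinner_block_signature:
  "cinner (block_op id_op 0 0 (- id_op) *\<^sub>V x) x = complex_of_real ((norm (fst x))\<^sup>2 - (norm (snd x))\<^sup>2)"
  by (simp add: cblinfun_simps cinner_prod_def cinner_minus_left cinner_self)

text \<open>Reduces the block operator inequality and equality to comparing the scalar energies of
  the two outputs with those of the inputs.\<close>

lemma cinner_block_congruence:
  "cinner ((block_op (T11\<^sup>\<dagger>) (T21\<^sup>\<dagger>) (T12\<^sup>\<dagger>) (T22\<^sup>\<dagger>) o\<^sub>C block_op id_op 0 0 (- id_op)
      o\<^sub>C block_op T11 T12 T21 T22) *\<^sub>V x) x
    = complex_of_real ((norm (T11 *\<^sub>V fst x + T12 *\<^sub>V snd x))\<^sup>2 - (norm (T21 *\<^sub>V fst x + T22 *\<^sub>V snd x))\<^sup>2)"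
proof -
  define y1 where "y1 = T11 *\<^sub>V fst x + T12 *\<^sub>V snd x"
  define y2 where "y2 = T21 *\<^sub>V fst x + T22 *\<^sub>V snd x"
  have "block_op T11 T12 T21 T22 *\<^sub>V x = (y1, y2)"
    by (simp add: block_op.rep_eq y1_def y2_def)
  hence "(block_op (T11\<^sup>\<dagger>) (T21\<^sup>\<dagger>) (T12\<^sup>\<dagger>) (T22\<^sup>\<dagger>) o\<^sub>C block_op id_op 0 0 (- id_op)
      o\<^sub>C block_op T11 T12 T21 T22) *\<^sub>V x
    = (T11\<^sup>\<dagger> *\<^sub>V y1 - T21\<^sup>\<dagger> *\<^sub>V y2, T12\<^sup>\<dagger> *\<^sub>V y1 - T22\<^sup>\<dagger> *\<^sub>V y2)"
    by (simp only: comp_op.rep_eq) (simp add: cblinfun_simps)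
  moreover have "cinner (T11\<^sup>\<dagger> *\<^sub>V y1 - T21\<^sup>\<dagger> *\<^sub>V y2) (fst x) + cinner (T12\<^sup>\<dagger> *\<^sub>V y1 - T22\<^sup>\<dagger> *\<^sub>V y2) (snd x)
      = cinner y1 y1 - cinner y2 y2"
    unfolding cinner_diff_left cinner_adj'[symmetric]
    by (subst (3) y1_def, subst (4) y2_def) (simp add: cinner_add_right)
  ultimately show ?thesis
    by (simp add: cinner_prod_def cinner_self flip: y1_def y2_def)
qed

text \<open>On the circle \<open>z * cnj z = 1\<close>, so
  \<open>id_op - z *\<^sub>C Z\<^sup>\<dagger>\<close> is \<open>z\<close> times the adjoint of
  \<open>z *\<^sub>C id_op - Z\<close>.\<close>

lemma resolvent_set_unit_circle:
  assumes "z \<in> resolvent_set Z" "z \<in> sphere 0 1"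
  shows "invertible_op (id_op - z *\<^sub>C Z\<^sup>\<dagger>)"
proof -
  have "z * cnj z = 1"
    using assms(2) complex_norm_square[of z] by simp
  hence "z *\<^sub>C (z *\<^sub>C id_op - Z)\<^sup>\<dagger> = id_op - z *\<^sub>C Z\<^sup>\<dagger>"
    by (simp add: adj_diff adj_scaleC scaleC_diff_right scaleC_scaleC scaleC_one)
  moreover have "invertible_op (z *\<^sub>C (z *\<^sub>C id_op - Z)\<^sup>\<dagger>)"
    using assms by (intro invertible_op_scaleC invertible_op_adj) (auto simp: resolvent_set_def)
  ultimately show ?thesis by simp
qed

theorem proposition1p3:
  fixes Z :: "'z::chilbert_space \<rightarrow>\<^sub>C 'z"
    and W :: "'y::chilbert_space ell2 \<rightarrow>\<^sub>C 'z"
    and Wt :: "'u::chilbert_space ell2 \<rightarrow>\<^sub>C 'z"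
    and C :: "'z \<rightarrow>\<^sub>C 'e::chilbert_space"
    and D :: "'y \<rightarrow>\<^sub>C 'e"
    and P \<Lambda> :: "'z \<rightarrow>\<^sub>C 'z"
    and B :: "'y \<rightarrow>\<^sub>C 'z"
    and Bt :: "'u \<rightarrow>\<^sub>C 'z"
    and Q :: "'e \<rightarrow>\<^sub>C 'e"
    and R :: "'u \<rightarrow>\<^sub>C 'u"
    and \<Upsilon>11 :: "complex \<Rightarrow> 'e \<rightarrow>\<^sub>C 'y"
    and \<Upsilon>12 :: "complex \<Rightarrow> 'u \<rightarrow>\<^sub>C 'y"
    and \<Upsilon>21 :: "complex \<Rightarrow> 'e \<rightarrow>\<^sub>C 'u"
    and \<Upsilon>22 :: "complex \<Rightarrow> 'u \<rightarrow>\<^sub>C 'u"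
  assumes "LTONP_data Z W Wt"
    and "strictly_positive_op \<Lambda>"
    and "admissible_pair Z W C D"
    and "P = W o\<^sub>C W\<^sup>\<dagger>"
    and "\<Lambda> = W o\<^sub>C W\<^sup>\<dagger> - Wt o\<^sub>C Wt\<^sup>\<dagger>"
    and "B = W o\<^sub>C embed_op"
    and "Bt = Wt o\<^sub>C embed_op"
    and "Q = inv_op (sqrt_op (id_op + C o\<^sub>C P o\<^sub>C (inv_op \<Lambda> - inv_op P) o\<^sub>C P o\<^sub>C C\<^sup>\<dagger>))"
    and "R = inv_op (sqrt_op (id_op + Bt\<^sup>\<dagger> o\<^sub>C inv_op \<Lambda> o\<^sub>C Bt))"
    and "\<Upsilon>11 = (\<lambda>z. D\<^sup>\<dagger> o\<^sub>C Q +
      z *\<^sub>C (B\<^sup>\<dagger> o\<^sub>C inv_op (id_op - z *\<^sub>C Z\<^sup>\<dagger>) o\<^sub>C inv_op \<Lambda> o\<^sub>C P o\<^sub>C C\<^sup>\<dagger> o\<^sub>C Q))"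
    and "\<Upsilon>12 = (\<lambda>z. B\<^sup>\<dagger> o\<^sub>C inv_op (id_op - z *\<^sub>C Z\<^sup>\<dagger>) o\<^sub>C inv_op \<Lambda> o\<^sub>C Bt o\<^sub>C R)"
    and "\<Upsilon>21 = (\<lambda>z.
      z *\<^sub>C (Bt\<^sup>\<dagger> o\<^sub>C inv_op (id_op - z *\<^sub>C Z\<^sup>\<dagger>) o\<^sub>C inv_op \<Lambda> o\<^sub>C P o\<^sub>C C\<^sup>\<dagger> o\<^sub>C Q))"
    and "\<Upsilon>22 = (\<lambda>z. R + Bt\<^sup>\<dagger> o\<^sub>C inv_op (id_op - z *\<^sub>C Z\<^sup>\<dagger>) o\<^sub>C inv_op \<Lambda> o\<^sub>C Bt o\<^sub>C R)"
  shows
    "(\<forall>x. (\<lambda>z. \<Upsilon>11 z *\<^sub>V x) \<in> hardy_H2) \<and> (\<forall>x. (\<lambda>z. \<Upsilon>21 z *\<^sub>V x) \<in> hardy_H2) \<and>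
     (\<forall>u. (\<lambda>z. \<Upsilon>12 z *\<^sub>V u) \<in> hardy_H2) \<and> (\<forall>u. (\<lambda>z. \<Upsilon>22 z *\<^sub>V u) \<in> hardy_H2) \<and>
     (\<forall>z\<in>ball 0 1.
       block_op ((\<Upsilon>11 z)\<^sup>\<dagger>) ((\<Upsilon>21 z)\<^sup>\<dagger>) ((\<Upsilon>12 z)\<^sup>\<dagger>) ((\<Upsilon>22 z)\<^sup>\<dagger>)
         o\<^sub>C block_op id_op 0 0 (- id_op) o\<^sub>C block_op (\<Upsilon>11 z) (\<Upsilon>12 z) (\<Upsilon>21 z) (\<Upsilon>22 z)
       \<preceq> block_op id_op 0 0 (- id_op)) \<and>
     (\<forall>z\<in>resolvent_set Z \<inter> sphere 0 1.
       block_op ((\<Upsilon>11 z)\<^sup>\<dagger>) ((\<Upsilon>21 z)\<^sup>\<dagger>) ((\<Upsilon>12 z)\<^sup>\<dagger>) ((\<Upsilon>22 z)\<^sup>\<dagger>)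
         o\<^sub>C block_op id_op 0 0 (- id_op) o\<^sub>C block_op (\<Upsilon>11 z) (\<Upsilon>12 z) (\<Upsilon>21 z) (\<Upsilon>22 z)
       = block_op id_op 0 0 (- id_op)) \<and>
     (\<forall>z\<in>ball 0 1. invertible_op (\<Upsilon>22 z)) \<and>
     (\<lambda>z. inv_op (\<Upsilon>22 z)) \<in> schur_class"
proof -

  \<comment> \<open>Consequences of the data: Stein equation and invertibility of
    \<open>P\<close>\<close>
  have ZW: "Z o\<^sub>C W = W o\<^sub>C shift_op" and ZWt: "Z o\<^sub>C Wt = Wt o\<^sub>C shift_op"
    using assms(1) by (simp_all add: LTONP_data_def)
  note P_def = assms(4) and B_def = assms(6) and Bt_def = assms(7)
  have \<Lambda>_adj: "\<Lambda>\<^sup>\<dagger> = \<Lambda>" and \<Lambda>_pos: "0 \<le> inner (\<Lambda> *\<^sub>V x) x" and \<Lambda>_inv: "invertible_op \<Lambda>" for x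
    using assms(2) by (auto simp: strictly_positive_op_def positive_op_iff)
  have inner_\<Lambda>: "inner (\<Lambda> *\<^sub>V x) x = (norm (W\<^sup>\<dagger> *\<^sub>V x))\<^sup>2 - (norm (Wt\<^sup>\<dagger> *\<^sub>V x))\<^sup>2" for x
    by (simp add: assms(5) cblinfun_simps inner_diff_left inner_adj power2_norm_eq_inner)
  have P_adj: "P\<^sup>\<dagger> = P"
    by (simp add: P_def adj_comp)
  have \<Lambda>_le_P: "inner (\<Lambda> *\<^sub>V x) x \<le> inner (P *\<^sub>V x) x" for x
    using inner_adj[of W "W\<^sup>\<dagger> *\<^sub>V x" x]
    by (simp add: inner_\<Lambda> P_def comp_op.rep_eq power2_norm_eq_inner)
  \<comment> \<open>\<open>P\<close> exceeds \<open>\<Lambda>\<close> by the positive operator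
    \<open>Wt o\<^sub>C Wt\<^sup>\<dagger>\<close>, so it inherits coercivity.\<close>
  have P_inv: "invertible_op P"
    using coercive_op_mono[OF strictly_positive_op_coercive[OF assms(2)] \<Lambda>_le_P]
    by (rule coercive_op_invertible)
  have stein: "inner (\<Lambda> *\<^sub>V (Z\<^sup>\<dagger> *\<^sub>V x)) (Z\<^sup>\<dagger> *\<^sub>V x) + (norm (B\<^sup>\<dagger> *\<^sub>V x))\<^sup>2 - (norm (Bt\<^sup>\<dagger> *\<^sub>V x))\<^sup>2
      = inner (\<Lambda> *\<^sub>V x) x" for x
    unfolding inner_\<Lambda> B_def Bt_def using norm_adj_stein[OF ZW, of x] norm_adj_stein[OF ZWt, of x]
    by simp
  have bdd: "power_bounded (Z\<^sup>\<dagger>)"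
    using power_bounded_adj[OF ZW] P_inv by (simp add: P_def)

  \<comment> \<open>The complementary pair and the two normalising operators\<close>
  define X where "X = P o\<^sub>C C\<^sup>\<dagger>"
  have "block_op D C B Z o\<^sub>C block_op id_op 0 0 P o\<^sub>C block_op (D\<^sup>\<dagger>) (B\<^sup>\<dagger>) (C\<^sup>\<dagger>) (Z\<^sup>\<dagger>)
      = block_op id_op 0 0 P"
    using assms(3) by (simp add: admissible_pair_def Let_def P_def B_def)
  \<comment> \<open>Applying the block identity to \<open>(g, 0)\<close> extracts its first column:
    \<open>D D\<^sup>* + C P C\<^sup>* = I\<close> and
    \<open>B D\<^sup>* + Z P C\<^sup>* = 0\<close>.\<close>
  from arg_cong[OF this, of "\<lambda>T. T *\<^sub>V (g, 0)" for g]
  have admissible: "D *\<^sub>V (D\<^sup>\<dagger> *\<^sub>V g) + C *\<^sub>V (X *\<^sub>V g) = g"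
    and orth: "Z *\<^sub>V (X *\<^sub>V g) + B *\<^sub>V (D\<^sup>\<dagger> *\<^sub>V g) = 0" for g
    by (simp_all add: cblinfun_simps X_def add.commute)

  define TQ where "TQ = id_op + C o\<^sub>C P o\<^sub>C (inv_op \<Lambda> - inv_op P) o\<^sub>C P o\<^sub>C C\<^sup>\<dagger>"
  define TR where "TR = id_op + Bt\<^sup>\<dagger> o\<^sub>C inv_op \<Lambda> o\<^sub>C Bt"
  have Q_def: "Q = inv_op (sqrt_op TQ)" and R_def: "R = inv_op (sqrt_op TR)"
    by (simp_all add: assms(8,9) TQ_def TR_def)
  have TQ_adj: "TQ\<^sup>\<dagger> = TQ" and TR_adj: "TR\<^sup>\<dagger> = TR"
    by (simp_all add: TQ_def TR_def adj_add adj_comp adj_diff adj_inv_op \<Lambda>_adj P_adj \<Lambda>_inv P_inv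
        comp_op_assoc)
  have TQ_apply: "TQ *\<^sub>V g = g + C *\<^sub>V (P *\<^sub>V (inv_op \<Lambda> *\<^sub>V (X *\<^sub>V g))) - C *\<^sub>V (X *\<^sub>V g)" for g
    by (simp add: TQ_def X_def cblinfun_simps P_inv)
  have inner_C: "inner (C *\<^sub>V (P *\<^sub>V x)) g = inner x (X *\<^sub>V g)" for x g
    by (simp add: X_def cblinfun_simps inner_adj P_adj)
  \<comment> \<open>The inverse of \<open>P\<close> in \<open>TQ\<close> contributes
    \<open>- C P C\<^sup>*\<close>, which together with the identity makes
    \<open>D D\<^sup>*\<close>. The result is exactly the energy of \<open>g\<close> in
    \<open>energy_balance\<close>.\<close>
  have inner_TQ: "inner (TQ *\<^sub>V g) g = inner (inv_op \<Lambda> *\<^sub>V (X *\<^sub>V g)) (X *\<^sub>V g) + (norm (D\<^sup>\<dagger> *\<^sub>V g))\<^sup>2" for g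
  proof -
    have "TQ *\<^sub>V g = D *\<^sub>V (D\<^sup>\<dagger> *\<^sub>V g) + C *\<^sub>V (P *\<^sub>V (inv_op \<Lambda> *\<^sub>V (X *\<^sub>V g)))"
      unfolding TQ_apply eq_diff_eq[THEN iffD2, OF admissible] by (simp add: algebra_simps)
    thus ?thesis
      using inner_adj[of D "D\<^sup>\<dagger> *\<^sub>V g" g] by (simp add: inner_add_left inner_C power2_norm_eq_inner)
  qed
  have inner_TR: "inner (TR *\<^sub>V v) v = inner (Bt *\<^sub>V v) (inv_op \<Lambda> *\<^sub>V (Bt *\<^sub>V v)) + (norm v)\<^sup>2" for v
    using inner_adj[of Bt v "inv_op \<Lambda> *\<^sub>V (Bt *\<^sub>V v)"]
    by (simp add: TR_def cblinfun_simps inner_add_left inner_add_right inner_commute power2_norm_eq_inner)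
  \<comment> \<open>The inequality \<open>\<Lambda> \<le> P\<close> must be reversed for the
    inverses. With \<open>y = \<Lambda>\<^sup>-\<^sup>1 P w\<close>, this follows by expanding the
    nonnegative form of \<open>\<Lambda>\<close> at \<open>w - y\<close> and replacing its
    \<open>w\<close> term by the larger form of \<open>P\<close>.\<close>
  have TQ_coercive: "coercive_op TQ"
  proof (rule coercive_op_ge_id)
    fix g
    define w where "w = C\<^sup>\<dagger> *\<^sub>V g"
    define y where "y = inv_op \<Lambda> *\<^sub>V (X *\<^sub>V g)"
    have Xg: "X *\<^sub>V g = P *\<^sub>V w" and \<Lambda>y: "\<Lambda> *\<^sub>V y = P *\<^sub>V w"
      by (simp_all add: X_def y_def w_def cblinfun_simps \<Lambda>_inv)
    have "inner (\<Lambda> *\<^sub>V w) y = inner (P *\<^sub>V w) w"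
      using inner_adj[of \<Lambda> w y] by (simp add: \<Lambda>_adj \<Lambda>y inner_commute)
    hence "inner (\<Lambda> *\<^sub>V (w - y)) (w - y) = inner (\<Lambda> *\<^sub>V w) w - 2 * inner (P *\<^sub>V w) w + inner y (P *\<^sub>V w)"
      by (simp add: cblinfun_simps \<Lambda>y inner_diff_left inner_diff_right inner_commute)
    hence "inner w (P *\<^sub>V w) \<le> inner y (P *\<^sub>V w)"
      using \<Lambda>_pos[of "w - y"] \<Lambda>_le_P[of w] inner_commute[of w "P *\<^sub>V w"] by linarith
    moreover have "TQ *\<^sub>V g = g + C *\<^sub>V (P *\<^sub>V y) - C *\<^sub>V (P *\<^sub>V w)"
      by (simp add: TQ_apply y_def Xg)
    hence "inner (TQ *\<^sub>V g) g = (norm g)\<^sup>2 + inner y (P *\<^sub>V w) - inner w (P *\<^sub>V w)"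
      by (simp add: inner_add_left inner_diff_left inner_C Xg power2_norm_eq_inner)
    ultimately show "(norm g)\<^sup>2 \<le> inner (TQ *\<^sub>V g) g" by linarith
  qed
  have TR_coercive: "coercive_op TR"
  proof (rule coercive_op_ge_id)
    fix v
    show "(norm v)\<^sup>2 \<le> inner (TR *\<^sub>V v) v"
      using \<Lambda>_pos[of "inv_op \<Lambda> *\<^sub>V (Bt *\<^sub>V v)"] by (simp add: inner_TR \<Lambda>_inv)
  qed

  \<comment> \<open>Energy balance at a fixed frequency\<close>
  have energy: "\<exists>\<xi>. (1 - (cmod z)\<^sup>2) * inner (\<Lambda> *\<^sub>V \<xi>) \<xi> + (norm (\<Upsilon>11 z *\<^sub>V e + \<Upsilon>12 z *\<^sub>V u))\<^sup>2
      - (norm (\<Upsilon>21 z *\<^sub>V e + \<Upsilon>22 z *\<^sub>V u))\<^sup>2 = (norm e)\<^sup>2 - (norm u)\<^sup>2"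
    if inv: "invertible_op (id_op - z *\<^sub>C Z\<^sup>\<dagger>)" for z e u
  proof -
    define g where "g = Q *\<^sub>V e"
    define v where "v = R *\<^sub>V u"
    define a where "a = inv_op \<Lambda> *\<^sub>V (X *\<^sub>V g)"
    define h where "h = inv_op \<Lambda> *\<^sub>V (Bt *\<^sub>V v)"
    \<comment> \<open>Both input channels are collected in one resolvent equation. It says
      \<open>w - h = z *\<^sub>C \<xi>\<close> with \<open>\<xi>\<close> the next state, so the two
      state energies differ by the factor \<open>(cmod z)\<^sup>2\<close>.\<close>
    define w where "w = inv_op (id_op - z *\<^sub>C Z\<^sup>\<dagger>) *\<^sub>V (z *\<^sub>C a + h)"
    define \<xi> where "\<xi> = Z\<^sup>\<dagger> *\<^sub>V w + a"
    have "(id_op - z *\<^sub>C Z\<^sup>\<dagger>) *\<^sub>V w = z *\<^sub>C a + h"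
      by (simp add: w_def inv)
    hence state: "w - h = z *\<^sub>C \<xi>"
      by (simp add: cblinfun_simps \<xi>_def scaleC_add_right algebra_simps)
    have w: "w = z *\<^sub>C (inv_op (id_op - z *\<^sub>C Z\<^sup>\<dagger>) *\<^sub>V a) + inv_op (id_op - z *\<^sub>C Z\<^sup>\<dagger>) *\<^sub>V h"
      by (simp add: w_def cblinfun_simps)
    have y1: "\<Upsilon>11 z *\<^sub>V e + \<Upsilon>12 z *\<^sub>V u = B\<^sup>\<dagger> *\<^sub>V w + D\<^sup>\<dagger> *\<^sub>V g"
      by (simp add: assms(10,11) w cblinfun_simps X_def g_def v_def a_def h_def)
    have y2: "\<Upsilon>21 z *\<^sub>V e + \<Upsilon>22 z *\<^sub>V u = Bt\<^sup>\<dagger> *\<^sub>V w + v"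
      by (simp add: assms(12,13) w cblinfun_simps X_def g_def v_def a_def h_def)
    have \<Lambda>h: "\<Lambda> *\<^sub>V h = Bt *\<^sub>V v"
      by (simp add: h_def \<Lambda>_inv)
    have "inner (\<Lambda> *\<^sub>V (z *\<^sub>C \<xi>)) (z *\<^sub>C \<xi>) = (cmod z)\<^sup>2 * inner (\<Lambda> *\<^sub>V \<xi>) \<xi>"
      unfolding cmod_power2
      by (simp add: cblinfun_simps cinner_simps power2_eq_square algebra_simps flip: Re_cinner)
    hence "inner (\<Lambda> *\<^sub>V (w - h)) (w - h) = (cmod z)\<^sup>2 * inner (\<Lambda> *\<^sub>V \<xi>) \<xi>"
      by (simp add: state)
    moreover have "inner (inv_op \<Lambda> *\<^sub>V (X *\<^sub>V g)) (X *\<^sub>V g) + (norm (D\<^sup>\<dagger> *\<^sub>V g))\<^sup>2 = (norm e)\<^sup>2"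
      using inner_inv_sqrt_op[OF TQ_coercive TQ_adj, of e] by (simp add: inner_TQ g_def Q_def)
    moreover have "inner (Bt *\<^sub>V v) h + (norm v)\<^sup>2 = (norm u)\<^sup>2"
      using inner_inv_sqrt_op[OF TR_coercive TR_adj, of u] by (simp add: inner_TR v_def h_def R_def)
    ultimately show ?thesis
      using energy_balance[where X = X and D = D, OF \<Lambda>_adj \<Lambda>_inv stein orth \<Lambda>h \<xi>_def[unfolded a_def]]
      unfolding y1 y2 by (intro exI[of _ \<xi>]) (simp add: algebra_simps)
  qed
  have energy_disc: "(norm (\<Upsilon>11 z *\<^sub>V e + \<Upsilon>12 z *\<^sub>V u))\<^sup>2 - (norm (\<Upsilon>21 z *\<^sub>V e + \<Upsilon>22 z *\<^sub>V u))\<^sup>2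
      \<le> (norm e)\<^sup>2 - (norm u)\<^sup>2" if z: "z \<in> ball 0 1" for z e u
  proof -
    obtain \<xi> where "(1 - (cmod z)\<^sup>2) * inner (\<Lambda> *\<^sub>V \<xi>) \<xi> + (norm (\<Upsilon>11 z *\<^sub>V e + \<Upsilon>12 z *\<^sub>V u))\<^sup>2
      - (norm (\<Upsilon>21 z *\<^sub>V e + \<Upsilon>22 z *\<^sub>V u))\<^sup>2 = (norm e)\<^sup>2 - (norm u)\<^sup>2"
      using energy[OF power_bounded_resolvent(1)[OF bdd z]] by blast
    moreover have "0 \<le> (1 - (cmod z)\<^sup>2) * inner (\<Lambda> *\<^sub>V \<xi>) \<xi>"
      using z by (intro mult_nonneg_nonneg \<Lambda>_pos) (simp add: power_le_one)
    ultimately show ?thesis by linarith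
  qed

  \<comment> \<open>Hardy class membership, the block relations and the inverse of
    \<open>\<Upsilon>22\<close>\<close>
  note H2 = hardy_H2_add hardy_H2_const hardy_H2_scaleC
    hardy_H2_observability[OF ZW bdd, folded B_def] hardy_H2_observability[OF ZWt bdd, folded Bt_def]
  have "(\<lambda>z. \<Upsilon>11 z *\<^sub>V x) \<in> hardy_H2" "(\<lambda>z. \<Upsilon>21 z *\<^sub>V x) \<in> hardy_H2"
    "(\<lambda>z. \<Upsilon>12 z *\<^sub>V u) \<in> hardy_H2" "(\<lambda>z. \<Upsilon>22 z *\<^sub>V u) \<in> hardy_H2" for x u
    by (simp_all add: assms(10-13) cblinfun_simps H2)
  moreover have "block_op ((\<Upsilon>11 z)\<^sup>\<dagger>) ((\<Upsilon>21 z)\<^sup>\<dagger>) ((\<Upsilon>12 z)\<^sup>\<dagger>) ((\<Upsilon>22 z)\<^sup>\<dagger>)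
      o\<^sub>C block_op id_op 0 0 (- id_op) o\<^sub>C block_op (\<Upsilon>11 z) (\<Upsilon>12 z) (\<Upsilon>21 z) (\<Upsilon>22 z)
      \<preceq> block_op id_op 0 0 (- id_op)" if "z \<in> ball 0 1" for z
    unfolding le_op_def positive_op_def minus_cblinfun.rep_eq cinner_diff_left
      cinner_block_signature cinner_block_congruence
    using energy_disc[OF that] by (simp add: complex_nonneg_Reals_iff)
  moreover have "block_op ((\<Upsilon>11 z)\<^sup>\<dagger>) ((\<Upsilon>21 z)\<^sup>\<dagger>) ((\<Upsilon>12 z)\<^sup>\<dagger>) ((\<Upsilon>22 z)\<^sup>\<dagger>)
      o\<^sub>C block_op id_op 0 0 (- id_op) o\<^sub>C block_op (\<Upsilon>11 z) (\<Upsilon>12 z) (\<Upsilon>21 z) (\<Upsilon>22 z)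
      = block_op id_op 0 0 (- id_op)" if "z \<in> resolvent_set Z \<inter> sphere 0 1" for z
  proof (rule cblinfun_eq_quadraticI)
    have z: "invertible_op (id_op - z *\<^sub>C Z\<^sup>\<dagger>)" "cmod z = 1"
      using that resolvent_set_unit_circle[of z Z] by auto
    fix x :: "'e \<times> 'u"
    show "cinner ((block_op ((\<Upsilon>11 z)\<^sup>\<dagger>) ((\<Upsilon>21 z)\<^sup>\<dagger>) ((\<Upsilon>12 z)\<^sup>\<dagger>) ((\<Upsilon>22 z)\<^sup>\<dagger>)
        o\<^sub>C block_op id_op 0 0 (- id_op) o\<^sub>C block_op (\<Upsilon>11 z) (\<Upsilon>12 z) (\<Upsilon>21 z) (\<Upsilon>22 z)) *\<^sub>V x) x
      = cinner (block_op id_op 0 0 (- id_op) *\<^sub>V x) x"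
      unfolding cinner_block_signature cinner_block_congruence of_real_eq_iff
      using energy[OF z(1), of "fst x" "snd x"] z(2) by simp
  qed
  \<comment> \<open>Feed in the input \<open>(0, u)\<close> and discard the nonnegative contribution
    of \<open>\<Upsilon>12\<close>.\<close>
  moreover have below: "norm u \<le> norm (\<Upsilon>22 z *\<^sub>V u)" if "z \<in> ball 0 1" for z u
  proof (rule power2_le_imp_le)
    have "(norm (\<Upsilon>12 z *\<^sub>V u))\<^sup>2 - (norm (\<Upsilon>22 z *\<^sub>V u))\<^sup>2 \<le> - (norm u)\<^sup>2"
      using energy_disc[OF that, of 0 u] by (simp add: cblinfun_simps)
    thus "(norm u)\<^sup>2 \<le> (norm (\<Upsilon>22 z *\<^sub>V u))\<^sup>2"
      using zero_le_power2[of "norm (\<Upsilon>12 z *\<^sub>V u)"] by linarith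
  qed simp
  have analytic: "analytic_on_disc \<Upsilon>22"
    unfolding assms(13)
    by (intro analytic_on_disc_add analytic_on_disc_const analytic_on_disc_comp_right
        analytic_on_disc_comp_left analytic_on_disc_resolvent bdd)
  \<comment> \<open>At the origin the resolvent is the identity, so \<open>\<Upsilon>22 0\<close> is
    \<open>TR\<close> times its inverse square root. This is the starting point for invertibility
    along the disc.\<close>
  have "\<Upsilon>22 0 = sqrt_op TR"
  proof (rule cblinfun_eqI)
    fix u
    note S = sqrt_op[OF TR_coercive TR_adj]
    have "inv_op (id_op :: 'z \<rightarrow>\<^sub>C 'z) = id_op"
      by (rule inv_op_eqI) simp_all
    hence "\<Upsilon>22 0 *\<^sub>V u = TR *\<^sub>V (R *\<^sub>V u)"
      by (simp add: assms(13) TR_def cblinfun_simps)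
    also have "\<dots> = (sqrt_op TR o\<^sub>C sqrt_op TR) *\<^sub>V (R *\<^sub>V u)"
      by (simp only: S(1))
    also have "\<dots> = sqrt_op TR *\<^sub>V u"
      by (simp add: comp_op.rep_eq R_def coercive_op_invertible[OF S(2)])
    finally show "\<Upsilon>22 0 *\<^sub>V u = sqrt_op TR *\<^sub>V u" .
  qed
  hence "invertible_op (\<Upsilon>22 0)"
    using coercive_op_invertible[OF sqrt_op(2)[OF TR_coercive TR_adj]] by simp
  note inv = invertible_op_on_disc[OF analytic this below]
  have "(\<lambda>z. inv_op (\<Upsilon>22 z)) \<in> schur_class"
    unfolding schur_class_def
    \<comment> \<open>The lower bound \<open>below\<close> serves a second time, now as the norm
      bound on the inverse.\<close>
    using analytic_on_disc_inv_op[OF analytic inv] norm_inv_op_le_one[OF inv below] by blast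
  ultimately show ?thesis
    using inv by blast
qed

end
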